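(* Let $p\ge 2$, $-\infty\le a<b\le+\infty$, let $h:(0,\infty)\to(0,\infty)$ be a continuous function, let $H:(0,\infty)\to\mathbb{R}$ be a locally absolutely continuous primitive of $h$ and $\mathcal{T}_h:=H/h:(0,\infty)\to\mathbb{R}$. Assume further that $H$ extends to a continuous function $\tilde H:[0,\infty)\to\mathbb{R}$. Let $\tilde{\mathcal{R}}^0_{\ge 0}(a,b)$ be the set of all $f\in W^{2,1}_{loc}((a,b))$ such that $f\ge 0$ a.e. on $(a,b)$, $$\liminf_{R\nearrow b}|f'(R)|^{p-2}f'(R)\tilde H(f(R))\le 0\quad\text{and}\quad\limsup_{r\searrow a}|f'(r)|^{p-2}f'(r)\tilde H(f(r))\ge 0 .$$ Then for every $f\in\tilde{\mathcal{R}}^0_{\ge 0}(a,b)$, $$\int_{(a,b)\cap\{x:f(x)>0\}}|f'(x)|^p h(f(x))\,dx\le\left(\sqrt{p-1}\right)^p\int_{(a,b)\cap\{x:f(x)>0\}}\left|f''(x)\,\mathcal{T}_h(f(x))\right|^{\frac p2}h(f(x))\,dx .$$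
   Context: Here $f\in W^{2,1}_{loc}$ is identified with its $C^1$ representative whose derivative $f'$ is locally absolutely continuous; $f''$ is the a.e. defined second derivative. Functions are real valued, and integrals of nonnegative functions are taken in $[0,+\infty]$. *)

theory Defs
  imports "HOL-Analysis.Analysis"
begin

text \<open>
  Absolute continuity on \<open>{c..d}\<close> in the epsilon-delta sense. A set \<open>D\<close> with
  \<open>D division_of \<Union>D\<close> is exactly a finite family of non-overlapping nonempty compact
  intervals \<open>K = {Inf K..Sup K}\<close>. (The library's \<open>absolutely_continuous\<close> concerns measures.)
\<close>

definition abs_cont_on_Icc :: "real \<Rightarrow> real \<Rightarrow> (real \<Rightarrow> real) \<Rightarrow> bool" where
  "abs_cont_on_Icc c d g \<longleftrightarrow>
     (\<forall>\<epsilon>>0. \<exists>\<delta>>0. \<forall>D. D division_of \<Union>D \<and> \<Union>D \<subseteq> {c..d} \<and> (\<Sum>K\<in>D. Sup K - Inf K) < \<delta>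
        \<longrightarrow> (\<Sum>K\<in>D. \<bar>g (Sup K) - g (Inf K)\<bar>) < \<epsilon>)"

definition locally_abs_cont_on :: "real set \<Rightarrow> (real \<Rightarrow> real) \<Rightarrow> bool" where
  "locally_abs_cont_on U g \<longleftrightarrow> (\<forall>c d. {c..d} \<subseteq> U \<longrightarrow> abs_cont_on_Icc c d g)"

text \<open>
  \<open>W\<^sup>2\<^sup>,\<^sup>1\<close>, local, on the open interval \<open>(a,b)\<close>: an element is identified with its \<open>C\<^sup>1\<close>
  representative, whose derivative is locally absolutely continuous. The second derivative is then
  \<open>deriv (deriv f)\<close>, a genuine derivative almost everywhere. Functions are total on the reals;
  their values outside \<open>(a,b)\<close> are irrelevant.
\<close>

definition W21_loc :: "ereal \<Rightarrow> ereal \<Rightarrow> (real \<Rightarrow> real) set" where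
  "W21_loc a b =
     {f. (\<forall>x\<in>einterval a b. f differentiable (at x)) \<and>
         continuous_on (einterval a b) (deriv f) \<and>
         locally_abs_cont_on (einterval a b) (deriv f)}"

definition T_transform :: "(real \<Rightarrow> real) \<Rightarrow> (real \<Rightarrow> real) \<Rightarrow> real \<Rightarrow> real" where
  "T_transform H h y = H y / h y"

text \<open>
  The one-sided limits at the possibly infinite endpoints are taken along the filters
  \<open>at_left b\<close>, \<open>at_right a\<close> on the extended reals.
  Where \<open>deriv f\<close> vanishes, the boundary expression is \<open>0\<close>, also for \<open>p = 2\<close>.
\<close>

definition boundary_term ::
    "real \<Rightarrow> (real \<Rightarrow> real) \<Rightarrow> (real \<Rightarrow> real) \<Rightarrow> real \<Rightarrow> real" where
  "boundary_term p Ht f x = \<bar>deriv f x\<bar> powr (p - 2) * deriv f x * Ht (f x)"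

definition R0_nonneg ::
    "real \<Rightarrow> (real \<Rightarrow> real) \<Rightarrow> ereal \<Rightarrow> ereal \<Rightarrow> (real \<Rightarrow> real) set" where
  "R0_nonneg p Ht a b =
     {f \<in> W21_loc a b.
        (AE x in lborel. x \<in> einterval a b \<longrightarrow> f x \<ge> 0) \<and>
        Liminf (at_left b) (\<lambda>R. ereal (boundary_term p Ht f (real_of_ereal R))) \<le> 0 \<and>
        Limsup (at_right a) (\<lambda>r. ereal (boundary_term p Ht f (real_of_ereal r))) \<ge> 0}"

end

theory Submission
  imports Defs
begin

text \<open>
  Let \<open>S\<close> be the open set where \<open>f > 0\<close>, let \<open>u = \<bar>f'\<bar>\<^sup>p\<^sup>-\<^sup>2 f' H(f)\<close> be the flux, and let
  \<open>A = \<bar>f'\<bar>\<^sup>p h(f)\<close> and \<open>B = \<bar>f'' T(f)\<bar>\<^sup>p\<^sup>/\<^sup>2 h(f)\<close> be the two integrands, with \<open>T = H / h\<close>.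
  Almost everywhere on \<open>S\<close> the derivative of the flux is \<open>u' = (p - 1) \<bar>f'\<bar>\<^sup>p\<^sup>-\<^sup>2 f'' H(f) + A\<close>. Bounding the first summand
  by Young's inequality with exponents \<open>p/(p-2)\<close> and \<open>p/2\<close> gives the pointwise inequality
  \<open>A \<le> (p - 1)\<^sup>p\<^sup>/\<^sup>2 B + (p/2) u'\<close> (lemma \<open>integrand_le_derivative\<close>), which already carries the
  constant \<open>(p - 1)\<^sup>p\<^sup>/\<^sup>2\<close>. Integrating it over a compact interval inside \<open>S\<close> leaves only
  the boundary term \<open>(p/2) (u(R) - u(r))\<close> (lemma \<open>energy_le_on_Icc\<close>).

  The interval is then enlarged to a connected component of \<open>S\<close>. At an endpoint of the component
  that is not an endpoint of \<open>(a,b)\<close>, the nonnegative function \<open>f\<close> attains its minimum \<open>0\<close>, so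
  \<open>f'\<close> vanishes there and \<open>u\<close> tends to \<open>0\<close> because \<open>H\<close> extends continuously to \<open>0\<close>. At \<open>a\<close> and \<open>b\<close>
  the assumptions on the upper and lower limits provide points at which \<open>u\<close> has the favourable
  sign up to an arbitrarily small error (lemmas \<open>boundary_term_upper_right\<close> and
  \<open>boundary_term_lower_left\<close>). Summation over the countably many components finishes the proof.

  What this rests on is Lebesgue's theory of absolutely continuous functions: such functions are
  differentiable almost everywhere (theorem \<open>abs_cont_differentiable_ae\<close>) and are recovered by
  integrating their derivative (theorem \<open>abs_cont_has_integral\<close>). The first is derived directly from
  the Vitali covering theorem, without passing through monotone functions: on a set where the lower
  and the upper derivate are separated by numbers \<open>m < M\<close>, intervals of slope at most \<open>m\<close> and, nested
  inside them, intervals of slope at least \<open>M\<close> cover almost the same set, so that absolute continuity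
  forces their sums of increments to agree nearly, which is impossible unless the set is null.
\<close>

section \<open>Increments over divisions\<close>

text \<open>
  The signed increment of \<open>g\<close> over a nonempty compact interval \<open>K\<close>. It is additive over
  divisions, and for the identity function it is the length of \<open>K\<close>. For \<open>K = {}\<close> the value is
  meaningless; members of divisions are never empty.
\<close>
definition increment :: "(real \<Rightarrow> real) \<Rightarrow> real set \<Rightarrow> real" where
  "increment g K = g (Sup K) - g (Inf K)"

lemma increment_Icc [simp]: "s \<le> t \<Longrightarrow> increment g {s..t} = g t - g s"
  by (simp add: increment_def)

lemma increment_uminus [simp]: "increment (\<lambda>x. - g x) K = - increment g K"
  by (simp add: increment_def)

lemma division_of_real_member:
  assumes "D division_of S" "K \<in> D"
  obtains s t :: real where "s \<le> t" "K = {s..t}"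
proof -
  obtain s t where "K = cbox s t" "K \<noteq> {}"
    using division_ofD[OF assms(1)] assms(2) by blast
  then show thesis
    using that[of s t] by (auto simp: cbox_interval)
qed

lemma abs_cont_on_Icc_increment:
  "abs_cont_on_Icc c d g \<longleftrightarrow>
     (\<forall>\<epsilon>>0. \<exists>\<delta>>0. \<forall>D. D division_of \<Union>D \<and> \<Union>D \<subseteq> {c..d} \<and> sum (increment (\<lambda>x. x)) D < \<delta>
        \<longrightarrow> (\<Sum>K\<in>D. \<bar>increment g K\<bar>) < \<epsilon>)"
  by (simp add: abs_cont_on_Icc_def increment_def)

lemma abs_cont_on_IccE:
  assumes "abs_cont_on_Icc c d g" "\<epsilon> > 0"
  obtains \<delta> where "\<delta> > 0"
    "\<And>D. D division_of \<Union>D \<Longrightarrow> \<Union>D \<subseteq> {c..d} \<Longrightarrow> sum (increment (\<lambda>x. x)) D < \<delta>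
      \<Longrightarrow> (\<Sum>K\<in>D. \<bar>increment g K\<bar>) < \<epsilon>"
  using assms(1)[unfolded abs_cont_on_Icc_increment, rule_format, OF assms(2)] by (elim exE conjE) simp

lemma abs_cont_on_Icc_uminus:
  "abs_cont_on_Icc c d g \<Longrightarrow> abs_cont_on_Icc c d (\<lambda>x. - g x)"
  by (simp add: abs_cont_on_Icc_increment)

lemma increment_tagged_division:
  assumes "p tagged_division_of {c..d}" "c \<le> d"
  shows "(\<Sum>(x,K)\<in>p. increment g K) = g d - g c"
  using additive_tagged_division_1[OF assms(2,1), of g] by (simp add: increment_def)

lemma increment_division:
  assumes "D division_of {c..d}" "c \<le> d"
  shows "sum (increment g) D = g d - g c"
proof -
  have "(\<lambda>K. (Inf K, K)) ` D tagged_division_of {c..d}"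
  proof (rule tagged_division_ofI)
    show "finite ((\<lambda>K. (Inf K, K)) ` D)" using assms by auto
    fix x K assume "(x, K) \<in> (\<lambda>K. (Inf K, K)) ` D"
    then have K: "K \<in> D" "x = Inf K" by auto
    obtain s t where "s \<le> t" "K = {s..t}" using division_of_real_member[OF assms(1) K(1)] .
    then show "x \<in> K" "\<exists>a b. K = cbox a b" using K by (auto simp: cbox_interval)
    show "K \<subseteq> {c..d}" using K assms(1) by blast
  next
    fix x1 K1 x2 K2 assume "(x1, K1) \<in> (\<lambda>K. (Inf K, K)) ` D" "(x2, K2) \<in> (\<lambda>K. (Inf K, K)) ` D" 
      "(x1, K1) \<noteq> (x2, K2)"
    then show "interior K1 \<inter> interior K2 = {}"
      using division_ofD(5)[OF assms(1)] by auto
  next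
    show "\<Union>{K. \<exists>x. (x, K) \<in> (\<lambda>K. (Inf K, K)) ` D} = {c..d}"
      using division_ofD(6)[OF assms(1)] by (auto simp: image_iff)
  qed
  from increment_tagged_division[OF this assms(2), of g]
  show ?thesis by (subst (asm) sum.reindex) (auto simp: inj_on_def)
qed

lemma continuous_on_abs_cont:
  assumes "abs_cont_on_Icc c d g"
  shows "continuous_on {c..d} g"
proof (unfold continuous_on_iff, intro ballI allI impI)
  fix x e :: real assume x: "x \<in> {c..d}" and "e > 0"
  with abs_cont_on_IccE[OF assms] obtain \<delta> where "\<delta> > 0" and \<delta>: 
    "\<And>D. D division_of \<Union>D \<Longrightarrow> \<Union>D \<subseteq> {c..d} \<Longrightarrow> sum (increment (\<lambda>x. x)) D < \<delta>
        \<Longrightarrow> (\<Sum>K\<in>D. \<bar>increment g K\<bar>) < e" by metis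
  have *: "\<bar>g t - g s\<bar> < e" if "s \<le> t" "c \<le> s" "t \<le> d" "t - s < \<delta>" for s t
  proof -
    have "{{s..t}} division_of \<Union>{{s..t}}"
      using that by (intro division_ofI) (auto simp: cbox_interval)
    from \<delta>[OF this] show ?thesis using that by simp
  qed
  show "\<exists>\<delta>>0. \<forall>x'\<in>{c..d}. dist x' x < \<delta> \<longrightarrow> dist (g x') (g x) < e"
  proof (intro exI conjI ballI impI)
    fix y assume "y \<in> {c..d}" "dist y x < \<delta>"
    then show "dist (g y) (g x) < e"
      using *[of x y] *[of y x] x by (cases "x \<le> y") (auto simp: dist_real_def)
  qed fact
qed

section \<open>Vitali coverings by intervals on which a function is steep\<close>

text \<open>
  The Vitali covering theorem on the line, in a finite form: if every point of \<open>S\<close> is interior to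
  arbitrarily short intervals with property \<open>Q\<close>, then finitely many disjoint such intervals inside
  \<open>U\<close> have total length at least the measure of \<open>S\<close>, up to \<open>e\<close>.
\<close>
lemma vitali_intervals:
  fixes S U :: "real set"
  assumes S: "S \<in> lmeasurable" "S \<subseteq> U" and "open U" and "e > 0"
    and Q: "\<And>x \<delta>. x \<in> S \<Longrightarrow> \<delta> > 0 \<Longrightarrow> \<exists>s t. s < x \<and> x < t \<and> t - s < \<delta> \<and> Q s t"
  obtains D where "finite D" "disjoint D" "D division_of \<Union>D" "\<Union>D \<subseteq> U"
    "\<And>K. K \<in> D \<Longrightarrow> \<exists>s t. s < t \<and> K = {s..t} \<and> Q s t"
    "measure lebesgue S < sum (increment (\<lambda>x. x)) D + e"
proof -
  define I where "I = {(y, r). 0 < r \<and> cball y r \<subseteq> U \<and> Q (y - r) (y + r)}"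
  have "\<exists>i. i \<in> I \<and> x \<in> cball (fst i) (snd i) \<and> snd i < \<delta>" if x: "x \<in> S" and "\<delta> > 0" for x \<delta>
  proof -
    obtain \<rho> where \<rho>: "\<rho> > 0" "ball x \<rho> \<subseteq> U"
      using x S(2) \<open>open U\<close> by (meson openE subsetD)
    obtain s t where st: "s < x" "x < t" "t - s < min \<delta> \<rho>" "Q s t"
      using Q[OF x, of "min \<delta> \<rho>"] \<open>\<delta> > 0\<close> \<rho> by auto
    define y r where "y = (s+t)/2" and "r = (t-s)/2"
    have yr: "y - r = s" "y + r = t" by (auto simp: y_def r_def field_simps)
    then have ball: "cball y r = {s..t}" by (simp add: cball_eq_atLeastAtMost)
    have r: "0 < r" "r < \<delta>" using st(1-3) by (auto simp: r_def)
    have "{s..t} \<subseteq> ball x \<rho>" using st by (auto simp: dist_real_def)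
    with \<rho> ball have "cball y r \<subseteq> U" by blast
    with r st(4) have "(y, r) \<in> I" 
      unfolding I_def by (simp add: yr)
    then show ?thesis using st(1,2) ball r(2)
      by (intro exI[of _ "(y, r)"]) simp
  qed
  from Vitali_covering_theorem_cballs[of I snd S fst, OF _ this]
  obtain C where C: "countable C" "C \<subseteq> I"
    and disj: "pairwise (\<lambda>i j. disjnt (cball (fst i) (snd i)) (cball (fst j) (snd j))) C"
    and neg: "negligible (S - (\<Union>i\<in>C. cball (fst i) (snd i)))"
    unfolding I_def by (auto simp: split_def)
  let ?B = "\<lambda>i::real\<times>real. cball (fst i) (snd i)"
  have meas: "S \<inter> ?B i \<in> lmeasurable" for i
    using S by (intro fmeasurable_Int_fmeasurable) auto
  obtain D' where D': "D' \<subseteq> (\<lambda>i. S \<inter> ?B i) ` C" "finite D'"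
    "measure lebesgue (\<Union>((\<lambda>i. S \<inter> ?B i) ` C)) - e < measure lebesgue (\<Union>D')"
  proof (rule measure_countable_Union_approachable[of "(\<lambda>i. S \<inter> ?B i) ` C" e "measure lebesgue S"])
    show "measure lebesgue (\<Union>D') \<le> measure lebesgue S" 
      if "D' \<subseteq> (\<lambda>i. S \<inter> ?B i) ` C" "finite D'" for D'
    proof (rule measure_mono_fmeasurable)
      show "\<Union>D' \<in> sets lebesgue"
        using that meas by (intro sets.finite_Union) blast+
    qed (use that S in auto)
  qed (use C meas \<open>e > 0\<close> in auto)
  then obtain F where F: "F \<subseteq> C" "finite F" "D' = (\<lambda>i. S \<inter> ?B i) ` F"
    by (meson finite_subset_image)
  define D where "D = ?B ` F"
  have st: "\<exists>s t. s < t \<and> K = {s..t} \<and> K \<subseteq> U \<and> Q s t" if "K \<in> D" for K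
  proof -
    obtain i where i: "i \<in> F" "K = ?B i" using \<open>K \<in> D\<close> unfolding D_def by blast
    obtain y r where yr: "i = (y, r)" by (cases i)
    have "(y, r) \<in> I" using C(2) F(1) i(1) yr by blast
    then have "0 < r" "cball y r \<subseteq> U" "Q (y - r) (y + r)" unfolding I_def by auto
    moreover have "K = {y-r..y+r}" "K = cball y r" using i(2) yr by (auto simp: cball_eq_atLeastAtMost)
    ultimately show ?thesis
      by (intro exI[of _ "y-r"] exI[of _ "y+r"]) simp
  qed
  have dj: "disjoint D"
  proof (rule pairwiseI)
    fix K L assume KL: "K \<in> D" "L \<in> D" "K \<noteq> L"
    then obtain i j where ij: "i \<in> F" "j \<in> F" "K = ?B i" "L = ?B j" unfolding D_def by blast
    with KL(3) have "i \<noteq> j" by auto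
    with pairwiseD[OF disj, of i j] F(1) ij show "disjnt K L" by blast
  qed
  have "finite D" using F D_def by simp
  have div: "D division_of \<Union>D"
  proof (rule division_ofI)
    fix K assume "K \<in> D" 
    then show "K \<subseteq> \<Union>D" by blast
    obtain s t where "s < t" "K = {s..t}" using st[OF \<open>K \<in> D\<close>] by blast
    then show "K \<noteq> {}" "\<exists>a b. K = cbox a b" by (auto simp: cbox_interval)
  next
    fix K1 K2 assume "K1 \<in> D" "K2 \<in> D" "K1 \<noteq> K2"
    then have "K1 \<inter> K2 = {}" using dj by (auto simp: pairwise_def disjnt_def)
    then show "interior K1 \<inter> interior K2 = {}" using interior_subset by blast
  qed (use \<open>finite D\<close> in auto)
  have "measure lebesgue S \<le> measure lebesgue (\<Union>((\<lambda>i. S \<inter> ?B i) ` C))"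
  proof -
    let ?T = "\<Union>((\<lambda>i. S \<inter> ?B i) ` C)"
    have T: "?T \<in> lmeasurable"
    proof (rule fmeasurableI2[OF S(1)])
      show "?T \<in> sets lebesgue"
        using C meas by (intro sets.countable_UN') auto
    qed auto
    have "measure lebesgue (?T \<union> (S - (\<Union>i\<in>C. ?B i))) = measure lebesgue ?T"
      by (rule measure_Un_null_set[OF fmeasurableD[OF T] neg[unfolded negligible_iff_null_sets]])
    moreover have "?T \<union> (S - (\<Union>i\<in>C. ?B i)) = S" by auto
    ultimately show ?thesis by simp
  qed
  also have "\<dots> < measure lebesgue (\<Union>D') + e" using D' by simp
  also have "measure lebesgue (\<Union>D') \<le> measure lebesgue (\<Union>D)"
    unfolding F D_def using F S
    by (intro measure_mono_fmeasurable sets.finite_Union) (use meas in \<open>auto intro!: fmeasurable.finite_Union\<close>)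
  also have "measure lebesgue (\<Union>D) \<le> (\<Sum>K\<in>D. measure lebesgue K)"
    using \<open>finite D\<close> unfolding D_def by (intro measure_Union_le) auto
  also have "\<dots> = sum (increment (\<lambda>x. x)) D"
    using st by (intro sum.cong) force+
  finally have "measure lebesgue S < sum (increment (\<lambda>x. x)) D + e" by simp
  then show thesis using that[of D] dj div st \<open>finite D\<close> by blast
qed

text \<open>
  The points of \<open>(c,d)\<close> that are interior to arbitrarily short intervals over which \<open>g\<close> has slope
  greater than \<open>q\<close>; the upper derivate of \<open>g\<close> is then at least \<open>q\<close>. Two choices matter. The point is strictly inside the interval, so that
  the set is a countable intersection of open sets and hence Borel without any measurability
  argument for \<open>g\<close>; and \<open>s\<close>, \<open>t\<close> need not lie in \<open>(c,d)\<close>, which is automatic for short intervals.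
  Points of small lower derivate are the points at which \<open>- g\<close> is steep.
\<close>
definition steep :: "(real \<Rightarrow> real) \<Rightarrow> real \<Rightarrow> real \<Rightarrow> real \<Rightarrow> real set" where
  "steep g c d q = {x \<in> {c<..<d}. \<forall>\<delta>>0. \<exists>s t. s < x \<and> x < t \<and> t - s < \<delta> \<and> q * (t - s) < g t - g s}"

lemma steep_subset: "steep g c d q \<subseteq> {c<..<d}"
  by (auto simp: steep_def)

lemma steep_borel: "steep g c d q \<in> sets borel"
proof -
  let ?V = "\<lambda>n::nat. \<Union>{{s<..<t} |s t. t - s < inverse (real (Suc n)) \<and> q * (t - s) < g t - g s}"
  have "steep g c d q = {c<..<d} \<inter> (\<Inter>n. ?V n)"
  proof (intro equalityI subsetI)
    fix x assume x: "x \<in> steep g c d q"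
    have "x \<in> ?V n" for n
    proof -
      obtain s t where "s < x" "x < t" "t - s < inverse (real (Suc n))" "q * (t - s) < g t - g s"
        using x unfolding steep_def by (auto dest: spec[of _ "inverse (real (Suc n))"])
      then show ?thesis by (intro UnionI[of "{s<..<t}"]) auto
    qed
    with x steep_subset show "x \<in> {c<..<d} \<inter> (\<Inter>n. ?V n)" by blast
  next
    fix x assume x: "x \<in> {c<..<d} \<inter> (\<Inter>n. ?V n)"
    have "\<exists>s t. s < x \<and> x < t \<and> t - s < \<delta> \<and> q * (t - s) < g t - g s" if \<delta>: "\<delta> > 0" for \<delta>
    proof -
      obtain n where n: "inverse (real (Suc n)) < \<delta>" using reals_Archimedean[OF \<delta>] by blast
      from x have "x \<in> ?V n" by blast
      then obtain s t where "x \<in> {s<..<t}" "t - s < inverse (real (Suc n))" "q * (t - s) < g t - g s"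
        by blast
      with n show ?thesis by (intro exI[of _ s] exI[of _ t]) auto
    qed
    with x show "x \<in> steep g c d q" by (simp add: steep_def)
  qed
  moreover have "open (?V n)" for n by (intro open_Union) auto
  ultimately show ?thesis by (auto intro!: sets.Int sets.countable_INT)
qed

lemma steep_lmeasurable: "steep g c d q \<in> lmeasurable"
proof (rule fmeasurableI2)
  show "{c<..<d} \<in> lmeasurable" by (metis box_real(1) lmeasurable_box)
  show "steep g c d q \<in> sets lebesgue" using steep_borel by (metis sets_completionI_sets sets_lborel)
qed (rule steep_subset)

lemma steep_vitali:
  assumes "S \<subseteq> steep g c d q" "S \<in> lmeasurable" "S \<subseteq> U" "open U" "e > 0"
  obtains D where "finite D" "disjoint D" "D division_of \<Union>D" "\<Union>D \<subseteq> U"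
    "\<And>K. K \<in> D \<Longrightarrow> \<exists>s t. s < t \<and> K = {s..t}"
    "q * sum (increment (\<lambda>x. x)) D \<le> sum (increment g) D"
    "measure lebesgue S < sum (increment (\<lambda>x. x)) D + e"
proof -
  have "\<exists>s t. s < x \<and> x < t \<and> t - s < \<delta> \<and> q * (t - s) < g t - g s" if "x \<in> S" "\<delta> > 0" for x \<delta>
    using assms(1) that unfolding steep_def by blast
  from vitali_intervals[OF assms(2-5) this]
  obtain D where D: "finite D" "disjoint D" "D division_of \<Union>D" "\<Union>D \<subseteq> U"
    "\<And>K. K \<in> D \<Longrightarrow> \<exists>s t. s < t \<and> K = {s..t} \<and> q * (t - s) < g t - g s"
    "measure lebesgue S < sum (increment (\<lambda>x. x)) D + e"
    by metis
  have "q * increment (\<lambda>x. x) K \<le> increment g K" if K: "K \<in> D" for K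
  proof -
    obtain s t where "s < t" "K = {s..t}" "q * (t - s) < g t - g s" using D(5)[OF K] by blast
    then show ?thesis by simp
  qed
  then have "q * sum (increment (\<lambda>x. x)) D \<le> sum (increment g) D"
    unfolding sum_distrib_left by (rule sum_mono)
  with D show thesis by (intro that[of D]) blast+
qed

lemma sum_increment_id_eq_measure:
  assumes "D division_of S"
  shows "sum (increment (\<lambda>x. x)) D = measure lebesgue S"
proof -
  have "sum (increment (\<lambda>x. x)) D = sum (measure lebesgue) D"
  proof (rule sum.cong)
    fix K assume "K \<in> D"
    then obtain s t where "s \<le> t" "K = {s..t}" using division_of_real_member[OF assms] by metis
    then show "increment (\<lambda>x. x) K = measure lebesgue K" by simp
  qed simp
  also have "\<dots> = measure lebesgue S"
    using content_division[OF assms] by simp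
  finally show ?thesis .
qed

section \<open>Almost everywhere differentiability of absolutely continuous functions\<close>

text \<open>
  The upper derivate is infinite only on a null set: within an interval shorter than the \<open>\<delta>\<close> that
  belongs to \<open>\<epsilon> = 1\<close>, disjoint intervals of slope at least \<open>n + 1\<close> have total length below
  \<open>1 / (n + 1)\<close>.
\<close>
lemma negligible_infinitely_steep:
  assumes ac: "abs_cont_on_Icc c d g"
  shows "negligible (\<Inter>n. steep g c d (real n))" (is "negligible ?S")
proof -
  have S: "?S \<in> sets lebesgue"
    using steep_lmeasurable by (intro sets.countable_INT) (auto simp: fmeasurable_def)
  obtain \<delta> where "\<delta> > 0" and \<delta>: "\<And>D. D division_of \<Union>D \<Longrightarrow> \<Union>D \<subseteq> {c..d} 
      \<Longrightarrow> sum (increment (\<lambda>x. x)) D < \<delta> \<Longrightarrow> (\<Sum>K\<in>D. \<bar>increment g K\<bar>) < 1"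
    by (rule abs_cont_on_IccE[OF ac zero_less_one]) (rule that)
  have small: "measure lebesgue (?S \<inter> {y<..<y+\<delta>/2}) = 0" for y
  proof -
    let ?T = "?S \<inter> {y<..<y+\<delta>/2}"
    have yl: "{y<..<y+\<delta>/2} \<in> lmeasurable" by (metis box_real(1) lmeasurable_box)
    have Tl: "?T \<in> lmeasurable" using S yl by (metis Int_commute fmeasurable_Int_fmeasurable)
    have TU: "?T \<subseteq> {c<..<d} \<inter> {y<..<y+\<delta>/2}" using steep_subset by blast
    have op: "open ({c<..<d} \<inter> {y<..<y+\<delta>/2})" by (intro open_Int) auto
    have pos: "inverse (real (Suc n)) > 0" for n by simp
    have bound: "measure lebesgue ?T \<le> 2 * inverse (real (Suc n))" for n
    proof -
      have sub: "?T \<subseteq> steep g c d (real (Suc n))" by blast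
      obtain D where D: "D division_of \<Union>D" "\<Union>D \<subseteq> {c<..<d} \<inter> {y<..<y+\<delta>/2}"
        "real (Suc n) * sum (increment (\<lambda>x. x)) D \<le> sum (increment g) D"
        "measure lebesgue ?T < sum (increment (\<lambda>x. x)) D + inverse (real (Suc n))"
        by (rule steep_vitali[OF sub Tl TU op pos[of n]]) (rule that)
      have fin: "\<Union>D \<in> lmeasurable" using D(1) by (metis lmeasurable_division)
      have "measure lebesgue (\<Union>D) \<le> measure lebesgue {y<..<y+\<delta>/2}"
        using D(2) yl fin by (intro measure_mono_fmeasurable) auto
      also have "\<dots> < \<delta>" using \<open>\<delta> > 0\<close> by simp
      finally have "sum (increment (\<lambda>x. x)) D < \<delta>" using sum_increment_id_eq_measure[OF D(1)] by simp
      then have "(\<Sum>K\<in>D. \<bar>increment g K\<bar>) < 1" using D(2) by (intro \<delta> D(1)) auto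
      moreover have "sum (increment g) D \<le> (\<Sum>K\<in>D. \<bar>increment g K\<bar>)" by (intro sum_mono) auto
      ultimately have "real (Suc n) * sum (increment (\<lambda>x. x)) D < 1" using D(3) by linarith
      then have "sum (increment (\<lambda>x. x)) D < inverse (real (Suc n))" 
        by (simp add: field_simps)
      with D(4) show ?thesis by simp
    qed
    have "(\<lambda>n. 2 * inverse (real (Suc n))) \<longlonglongrightarrow> 2 * 0" 
      by (intro tendsto_intros LIMSEQ_inverse_real_of_nat)
    then have "measure lebesgue ?T \<le> 2 * 0" 
      by (rule LIMSEQ_le_const) (use bound in blast)
    then show ?thesis using measure_nonneg[of lebesgue ?T] by linarith
  qed
  have "?S \<subseteq> (\<Union>y\<in>\<rat>. ?S \<inter> {y<..<y+\<delta>/2})"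
  proof
    fix x assume "x \<in> ?S"
    obtain y where "y \<in> \<rat>" "x - \<delta>/2 < y" "y < x" using Rats_dense_in_real[of "x-\<delta>/2" x] \<open>\<delta> > 0\<close> by auto
    with \<open>x \<in> ?S\<close> show "x \<in> (\<Union>y\<in>\<rat>. ?S \<inter> {y<..<y+\<delta>/2})" by (intro UN_I[of y]) auto
  qed
  moreover have "negligible (\<Union>y\<in>\<rat>. ?S \<inter> {y<..<y+\<delta>/2})"
  proof (rule negligible_countable_Union)
    fix T assume "T \<in> (\<lambda>y. ?S \<inter> {y<..<y+\<delta>/2}) ` \<rat>"
    then obtain y where T: "T = ?S \<inter> {y<..<y+\<delta>/2}" by blast
    have "{y<..<y+\<delta>/2} \<in> lmeasurable" by (metis box_real(1) lmeasurable_box)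
    then have "T \<in> lmeasurable" using S T by (metis Int_commute fmeasurable_Int_fmeasurable)
    with small[of y] T show "negligible T" by (simp add: negligible_iff_measure)
  qed (simp add: countable_rat)
  ultimately show ?thesis using negligible_subset by blast
qed

text \<open>
  If each interval of a disjoint family \<open>D\<close> contains a family \<open>E I\<close>, and \<open>E\<close> fills \<open>D\<close> up to a set
  of small measure, then the increments over \<open>D\<close> and over \<open>E\<close> have almost the same sum: the gaps
  form a division of small total length, to which absolute continuity applies.
\<close>
lemma abs_cont_on_Icc_nested_families:
  assumes ac: "abs_cont_on_Icc c d g" and "\<epsilon> > 0"
  shows "\<exists>\<delta>>0. \<forall>D E. D division_of \<Union>D \<and> disjoint D \<and> \<Union>D \<subseteq> {c..d} \<and>
       (\<forall>I\<in>D. E I division_of \<Union>(E I) \<and> \<Union>(E I) \<subseteq> I) \<and>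
       sum (increment (\<lambda>x. x)) D - (\<Sum>I\<in>D. sum (increment (\<lambda>x. x)) (E I)) < \<delta>
     \<longrightarrow> \<bar>sum (increment g) D - (\<Sum>I\<in>D. sum (increment g) (E I))\<bar> < \<epsilon>"
proof -
  obtain \<delta> where "\<delta> > 0" and \<delta>: "\<And>D. D division_of \<Union>D \<Longrightarrow> \<Union>D \<subseteq> {c..d} 
      \<Longrightarrow> sum (increment (\<lambda>x. x)) D < \<delta> \<Longrightarrow> (\<Sum>K\<in>D. \<bar>increment g K\<bar>) < \<epsilon>"
    by (rule abs_cont_on_IccE[OF ac \<open>\<epsilon> > 0\<close>]) (rule that)
  have "\<bar>sum (increment g) D - (\<Sum>I\<in>D. sum (increment g) (E I))\<bar> < \<epsilon>"
    if *: "D division_of \<Union>D \<and> disjoint D \<and> \<Union>D \<subseteq> {c..d} \<and>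
       (\<forall>I\<in>D. E I division_of \<Union>(E I) \<and> \<Union>(E I) \<subseteq> I) \<and>
       sum (increment (\<lambda>x. x)) D - (\<Sum>I\<in>D. sum (increment (\<lambda>x. x)) (E I)) < \<delta>" for D E
  proof -
    have D: "D division_of \<Union>D" "disjoint D" "\<Union>D \<subseteq> {c..d}"
      and E: "\<And>I. I \<in> D \<Longrightarrow> E I division_of \<Union>(E I)" "\<And>I. I \<in> D \<Longrightarrow> \<Union>(E I) \<subseteq> I"
      and small: "sum (increment (\<lambda>x. x)) D - (\<Sum>I\<in>D. sum (increment (\<lambda>x. x)) (E I)) < \<delta>"
      using * by simp_all
    have "\<exists>q. E I \<subseteq> q \<and> q division_of I" if I: "I \<in> D" for I
    proof -
      obtain s t where "s \<le> t" "I = {s..t}" using division_of_real_member[OF D(1) I] .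
      then have st: "I = cbox s t" by (simp add: cbox_interval)
      show ?thesis
        using partial_division_extend_interval[OF E(1)[OF I], of s t] E(2)[OF I] unfolding st by metis
    qed
    then obtain q where q: "\<And>I. I \<in> D \<Longrightarrow> E I \<subseteq> q I" "\<And>I. I \<in> D \<Longrightarrow> q I division_of I"
      by metis
    define G where "G = (\<Union>I\<in>D. q I - E I)"
    have finD: "finite D" using D(1) by auto
    have finq: "finite (q I)" if "I \<in> D" for I using q(2)[OF that] by auto
    have qsub: "K \<subseteq> I" "K \<noteq> {}" if "I \<in> D" "K \<in> q I" for I K
      using q(2)[OF that(1)] that(2) by blast+
    have same: "I = J" if "I \<in> D" "J \<in> D" "K \<in> q I" "L \<in> q J" "K \<inter> L \<noteq> {}" for I J K L
    proof (rule ccontr)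
      assume "I \<noteq> J"
      then have "I \<inter> J = {}" using D(2) that(1,2) by (auto simp: pairwise_def disjnt_def)
      moreover have "K \<subseteq> I" "L \<subseteq> J" using qsub that by blast+
      ultimately show False using that(5) by blast
    qed
    have G: "G division_of \<Union>G"
    proof (rule division_ofI)
      show "finite G" unfolding G_def using finD finq by blast
      fix K assume K: "K \<in> G"
      then show "K \<subseteq> \<Union>G" by blast
      obtain I where I: "I \<in> D" "K \<in> q I" using K G_def by blast
      show "K \<noteq> {}" "\<exists>a b. K = cbox a b" using division_ofD(3,4)[OF q(2)[OF I(1)] I(2)] by auto
    next
      fix K L assume KL: "K \<in> G" "L \<in> G" "K \<noteq> L"
      then obtain I J where IJ: "I \<in> D" "J \<in> D" "K \<in> q I" "L \<in> q J" unfolding G_def by blast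
      show "interior K \<inter> interior L = {}"
      proof (cases "I = J")
        case True
        with IJ KL q(2) show ?thesis by (metis division_ofD(5))
      next
        case False
        with same[OF IJ] interior_subset show ?thesis by blast
      qed
    qed simp
    have sumG: "sum (increment k) G = sum (increment k) D - (\<Sum>I\<in>D. sum (increment k) (E I))" for k
    proof -
      have "sum (increment k) G = (\<Sum>I\<in>D. sum (increment k) (q I - E I))"
        unfolding G_def
      proof (rule sum.UNION_disjoint)
        show "\<forall>I\<in>D. \<forall>J\<in>D. I \<noteq> J \<longrightarrow> (q I - E I) \<inter> (q J - E J) = {}"
          using same qsub(2) by (metis DiffE Int_absorb disjoint_iff)
      qed (use finD finq in auto)
      also have "\<dots> = (\<Sum>I\<in>D. increment k I - sum (increment k) (E I))"
      proof (rule sum.cong)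
        fix I assume I: "I \<in> D"
        obtain s t where st: "s \<le> t" "I = {s..t}" using division_of_real_member[OF D(1) I] .
        have "sum (increment k) (q I) = increment k I"
          using increment_division[of "q I" s t k] q(2)[OF I] st by simp
        then show "sum (increment k) (q I - E I) = increment k I - sum (increment k) (E I)"
          using sum_diff[OF finq[OF I] q(1)[OF I], of "increment k"] by simp
      qed simp
      finally show ?thesis by (simp add: sum_subtractf)
    qed
    have "\<Union>G \<subseteq> {c..d}" using D(3) qsub(1) unfolding G_def by blast
    then have "(\<Sum>K\<in>G. \<bar>increment g K\<bar>) < \<epsilon>"
      using \<delta>[OF G] small by (simp add: sumG)
    then show ?thesis using sum_abs[of "increment g" G] by (simp add: sumG)
  qed
  with \<open>\<delta> > 0\<close> show ?thesis by (intro exI[of _ \<delta>] conjI allI impI)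
qed

text \<open>
  For \<open>p < q\<close>, only the points of a null set have both arbitrarily short intervals of slope less
  than \<open>p\<close> and arbitrarily short intervals of slope greater than \<open>q\<close> around them. The set is covered, up to small measure, by intervals \<open>D\<close> of slope at most \<open>p\<close>, and inside these by
  intervals \<open>E\<close> of slope at least \<open>q\<close>. As \<open>D\<close> stays inside an open set hardly larger than the given
  one, \<open>E\<close> nearly fills \<open>D\<close>, so the sums of increments nearly agree, which bounds the total length
  of \<open>D\<close> by a multiple of \<open>e\<close>.
\<close>
lemma negligible_steep_up_and_down:
  assumes ac: "abs_cont_on_Icc c d g" and "p < q"
  shows "negligible (steep g c d q \<inter> steep (\<lambda>x. - g x) c d (- p))" (is "negligible ?S")
proof -
  have S: "?S \<in> lmeasurable" using steep_lmeasurable by (intro fmeasurable.Int)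
  have Scd: "?S \<subseteq> {c<..<d}" using steep_subset by blast
  have bound: "measure lebesgue ?S \<le> e * ((1 + \<bar>q\<bar>) / (q - p) + 1)" if "e > 0" for e
  proof -
    obtain \<delta> where "\<delta> > 0" and \<delta>: "\<And>D E. D division_of \<Union>D \<and> disjoint D \<and> \<Union>D \<subseteq> {c..d} \<and>
       (\<forall>I\<in>D. E I division_of \<Union>(E I) \<and> \<Union>(E I) \<subseteq> I) \<and>
       sum (increment (\<lambda>x. x)) D - (\<Sum>I\<in>D. sum (increment (\<lambda>x. x)) (E I)) < \<delta>
     \<Longrightarrow> \<bar>sum (increment g) D - (\<Sum>I\<in>D. sum (increment g) (E I))\<bar> < e"
      using abs_cont_on_Icc_nested_families[OF ac \<open>e > 0\<close>] by (elim exE conjE) simp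
    define \<eta> where "\<eta> = min \<delta> e / 2"
    have \<eta>: "\<eta> > 0" "2 * \<eta> \<le> \<delta>" "2 * \<eta> \<le> e" using \<open>\<delta> > 0\<close> \<open>e > 0\<close> by (auto simp: \<eta>_def)
    obtain V where V: "open V" "?S \<subseteq> V" "V - ?S \<in> lmeasurable" "emeasure lebesgue (V - ?S) < ennreal \<eta>"
      using sets_lebesgue_outer_open[OF fmeasurableD[OF S] \<eta>(1)] .
    define U where "U = V \<inter> {c<..<d}"
    have U: "open U" "?S \<subseteq> U" "U \<subseteq> {c<..<d}" unfolding U_def using V Scd by auto
    have Ul: "U \<in> lmeasurable" unfolding U_def using V(1) by (intro bounded_set_imp_lmeasurable) auto
    have US: "measure lebesgue (U - ?S) < \<eta>"
    proof -
      have "measure lebesgue (U - ?S) \<le> measure lebesgue (V - ?S)"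
        using V(3) Ul S by (intro measure_mono_fmeasurable) (auto simp: U_def)
      also have "\<dots> < \<eta>"
        using V(3,4) \<eta>(1) by (simp add: emeasure_eq_measure2 ennreal_less_iff)
      finally show ?thesis .
    qed
    obtain D where D: "finite D" "disjoint D" "D division_of \<Union>D" "\<Union>D \<subseteq> U"
      "\<And>K. K \<in> D \<Longrightarrow> \<exists>s t. s < t \<and> K = {s..t}"
      "- p * sum (increment (\<lambda>x. x)) D \<le> sum (increment (\<lambda>x. - g x)) D"
      "measure lebesgue ?S < sum (increment (\<lambda>x. x)) D + e"
      by (rule steep_vitali[OF Int_lower2 S U(2,1) \<open>e > 0\<close>]) (rule that)
    \<comment> \<open>One of these errors occurs for each member of \<open>D\<close>; together they stay below \<open>\<eta>\<close>.\<close>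
    define \<theta> where "\<theta> = \<eta> / (real (card D) + 1)"
    have "\<theta> > 0" using \<eta>(1) by (simp add: \<theta>_def)
    have il: "interior I \<in> lmeasurable" "measure lebesgue (interior I) = increment (\<lambda>x. x) I" if "I \<in> D" for I
    proof -
      obtain s t where "s < t" "I = {s..t}" using D(5)[OF \<open>I \<in> D\<close>] by blast
      then show "interior I \<in> lmeasurable" "measure lebesgue (interior I) = increment (\<lambda>x. x) I"
        using lmeasurable_box[of s t] by (auto simp: box_real)
    qed
    have "\<exists>E. E division_of \<Union>E \<and> \<Union>E \<subseteq> interior I \<and> q * sum (increment (\<lambda>x. x)) E \<le> sum (increment g) E
        \<and> measure lebesgue (?S \<inter> interior I) < sum (increment (\<lambda>x. x)) E + \<theta>" if "I \<in> D" for I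
    proof -
      have 1: "?S \<inter> interior I \<subseteq> steep g c d q" by blast
      have 2: "?S \<inter> interior I \<in> lmeasurable" by (rule fmeasurable.Int[OF S il(1)[OF that]])
      show ?thesis
        by (rule steep_vitali[OF 1 2 Int_lower2 open_interior \<open>\<theta> > 0\<close>]) blast
    qed
    then obtain E where E: "\<And>I. I \<in> D \<Longrightarrow> E I division_of \<Union>(E I)" "\<And>I. I \<in> D \<Longrightarrow> \<Union>(E I) \<subseteq> interior I"
       "\<And>I. I \<in> D \<Longrightarrow> q * sum (increment (\<lambda>x. x)) (E I) \<le> sum (increment g) (E I)"
       "\<And>I. I \<in> D \<Longrightarrow> measure lebesgue (?S \<inter> interior I) < sum (increment (\<lambda>x. x)) (E I) + \<theta>"
      by metis
    let ?d = "sum (increment (\<lambda>x. x)) D" and ?e = "\<Sum>I\<in>D. sum (increment (\<lambda>x. x)) (E I)"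
    have gap: "?d - ?e < 2 * \<eta>"
    proof -
      have "?d - ?e = (\<Sum>I\<in>D. increment (\<lambda>x. x) I - sum (increment (\<lambda>x. x)) (E I))"
        by (simp add: sum_subtractf)
      also have "\<dots> \<le> (\<Sum>I\<in>D. measure lebesgue (interior I - ?S) + \<theta>)"
      proof (rule sum_mono)
        fix I assume I: "I \<in> D"
        have "measure lebesgue (interior I - ?S) = measure lebesgue (interior I) - measure lebesgue (?S \<inter> interior I)"
          using measurable_measure_Diff[OF il(1)[OF I], of "?S \<inter> interior I"] S il(1)[OF I]
          by (simp add: Diff_Int_distrib Diff_Int fmeasurableD sets.Int)
        then show "increment (\<lambda>x. x) I - sum (increment (\<lambda>x. x)) (E I) \<le> measure lebesgue (interior I - ?S) + \<theta>"
          using E(4)[OF I] il(2)[OF I] by linarith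
      qed
      also have "\<dots> = (\<Sum>I\<in>D. measure lebesgue (interior I - ?S)) + card D * \<theta>"
        by (simp add: sum.distrib)
      also have "(\<Sum>I\<in>D. measure lebesgue (interior I - ?S)) = measure lebesgue (\<Union>I\<in>D. interior I - ?S)"
      proof (rule measure_UNION'[symmetric])
        show "pairwise (\<lambda>I J. disjnt (interior I - ?S) (interior J - ?S)) D"
        proof (rule pairwiseI)
          fix I J assume "I \<in> D" "J \<in> D" "I \<noteq> J"
          then have "interior I \<inter> interior J = {}" using division_ofD(5)[OF D(3)] by blast
          then show "disjnt (interior I - ?S) (interior J - ?S)" unfolding disjnt_def by blast
        qed
        show "interior I - ?S \<in> lmeasurable" if "I \<in> D" for I
          by (rule fmeasurable.Diff[OF il(1)[OF that] S])
      qed fact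
      also have "\<dots> \<le> measure lebesgue (U - ?S)"
      proof (rule measure_mono_fmeasurable)
        show "(\<Union>I\<in>D. interior I - ?S) \<subseteq> U - ?S"
        proof (intro UN_least Diff_mono)
          show "interior I \<subseteq> U" if "I \<in> D" for I
            using D(4) that interior_subset[of I] by blast
        qed simp
        show "(\<Union>I\<in>D. interior I - ?S) \<in> sets lebesgue"
          using il(1) S D(1) by (intro sets.finite_UN sets.Diff fmeasurableD) 
        show "U - ?S \<in> lmeasurable" by (rule fmeasurable.Diff[OF Ul S])
      qed
      also have "real (card D) * \<theta> \<le> \<eta>" using \<eta>(1) by (simp add: \<theta>_def field_simps)
      finally show ?thesis using US by linarith
    qed
    have EI: "\<Union>(E I) \<subseteq> I" if "I \<in> D" for I using E(2)[OF that] interior_subset by blast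
    have "\<bar>sum (increment g) D - (\<Sum>I\<in>D. sum (increment g) (E I))\<bar> < e"
    proof (rule \<delta>, intro conjI ballI)
      show "\<Union>D \<subseteq> {c..d}" using D(4) U(3) greaterThanLessThan_subseteq_atLeastAtMost_iff by blast
      show "?d - ?e < \<delta>" using gap \<eta>(2) by linarith
    qed (use D(2,3) E(1) EI in blast)+
    moreover have "q * ?e \<le> (\<Sum>I\<in>D. sum (increment g) (E I))"
      unfolding sum_distrib_left[of q "\<lambda>I. sum (increment (\<lambda>x. x)) (E I)"] using E(3) by (rule sum_mono)
    moreover have "sum (increment g) D \<le> p * ?d" using D(6) by (simp add: sum_negf)
    ultimately have qe: "q * ?e \<le> p * ?d + e" by linarith
    have ed: "?e \<le> ?d"
    proof (rule sum_mono)
      fix I assume I: "I \<in> D"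
      have "sum (increment (\<lambda>x. x)) (E I) = measure lebesgue (\<Union>(E I))"
        by (rule sum_increment_id_eq_measure[OF E(1)[OF I]])
      also have "\<dots> \<le> measure lebesgue (interior I)"
        using E(1,2) I il by (intro measure_mono_fmeasurable) (auto intro: fmeasurableD lmeasurable_division)
      finally show "sum (increment (\<lambda>x. x)) (E I) \<le> increment (\<lambda>x. x) I" using il[OF I] by simp
    qed
    \<comment> \<open>The sign of \<open>q\<close> is unknown.\<close>
    have "q * (?d - ?e) \<le> \<bar>q\<bar> * (?d - ?e)" using ed by (intro mult_right_mono) auto
    also have "\<dots> \<le> \<bar>q\<bar> * e" using gap \<eta>(3) by (intro mult_left_mono) auto
    finally have "(q - p) * ?d \<le> e * (1 + \<bar>q\<bar>)" using qe by (simp add: algebra_simps)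
    then have "?d \<le> e * (1 + \<bar>q\<bar>) / (q - p)" using \<open>p < q\<close> by (simp add: pos_le_divide_eq mult.commute)
    then show ?thesis using D(7) by (simp add: algebra_simps)
  qed
  have "measure lebesgue ?S \<le> 0"
  proof (rule field_le_epsilon)
    fix e :: real assume "e > 0"
    have c: "(1 + \<bar>q\<bar>) / (q - p) + 1 > 0" using \<open>p < q\<close> by (intro add_nonneg_pos divide_nonneg_nonneg) auto
    show "measure lebesgue ?S \<le> 0 + e"
      using bound[of "e / ((1 + \<bar>q\<bar>) / (q - p) + 1)"] c \<open>e > 0\<close> by simp
  qed
  then show ?thesis using S measure_nonneg[of lebesgue ?S] by (simp add: negligible_iff_measure order.antisym)
qed

text \<open>
  A point outside all the exceptional sets is a point of differentiability. The derivative is the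
  supremum of the rational lower bounds for the slopes near \<open>x\<close>; slopes over intervals with \<open>x\<close> in
  the interior control those with \<open>x\<close> as an endpoint by continuity.
\<close>
lemma differentiable_if_not_steep:
  fixes g :: "real \<Rightarrow> real"
  assumes x: "x \<in> {c<..<d}" and cont: "isCont g x"
    and up: "x \<notin> steep g c d M" and down: "x \<notin> steep (\<lambda>x. - g x) c d M'"
    and gap: "\<And>p q. p \<in> \<rat> \<Longrightarrow> q \<in> \<rat> \<Longrightarrow> p < q \<Longrightarrow> x \<notin> steep g c d q \<inter> steep (\<lambda>x. - g x) c d (- p)"
  shows "g differentiable (at x)"
proof -
  define P where "P q \<longleftrightarrow> (\<exists>\<delta>>0. \<forall>s t. s < x \<and> x < t \<and> t - s < \<delta> \<longrightarrow> g t - g s \<le> q * (t - s))" for q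
  define R where "R p \<longleftrightarrow> (\<exists>\<delta>>0. \<forall>s t. s < x \<and> x < t \<and> t - s < \<delta> \<longrightarrow> p * (t - s) \<le> g t - g s)" for p
  have steep_iff: "x \<notin> steep k c d q \<longleftrightarrow>
      (\<exists>\<delta>>0. \<forall>s t. s < x \<and> x < t \<and> t - s < \<delta> \<longrightarrow> \<not> q * (t - s) < k t - k s)" for k q
    using x unfolding steep_def mem_Collect_eq by blast
  have P_iff: "x \<notin> steep g c d q \<longleftrightarrow> P q" for q
    by (simp only: steep_iff P_def not_less)
  have "\<not> - p * (t - s) < - g t - - g s \<longleftrightarrow> p * (t - s) \<le> g t - g s" for p s t
    by (auto simp: algebra_simps)
  then have R_iff: "x \<notin> steep (\<lambda>x. - g x) c d (- p) \<longleftrightarrow> R p" for p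
    by (simp only: steep_iff R_def)
  have RP: "p \<le> q" if "R p" "P q" for p q
  proof -
    obtain \<delta>1 \<delta>2 where \<delta>: "\<delta>1 > 0" "\<delta>2 > 0"
      "\<And>s t. s < x \<Longrightarrow> x < t \<Longrightarrow> t - s < \<delta>1 \<Longrightarrow> p * (t - s) \<le> g t - g s"
      "\<And>s t. s < x \<Longrightarrow> x < t \<Longrightarrow> t - s < \<delta>2 \<Longrightarrow> g t - g s \<le> q * (t - s)"
      using \<open>R p\<close> \<open>P q\<close> unfolding P_def R_def by metis
    define r where "r = min \<delta>1 \<delta>2 / 4"
    have r: "r > 0" "2 * r < \<delta>1" "2 * r < \<delta>2" using \<delta>(1,2) by (auto simp: r_def)
    have 2: "x + r - (x - r) = 2 * r" by simp
    have "p * (2 * r) \<le> g (x + r) - g (x - r)"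
      using \<delta>(3)[of "x - r" "x + r"] r unfolding 2 by simp
    also have "\<dots> \<le> q * (2 * r)"
      using \<delta>(4)[of "x - r" "x + r"] r unfolding 2 by simp
    finally have "p * (2 * r) \<le> q * (2 * r)" .
    with r(1) show ?thesis by (simp add: mult_le_cancel_right)
  qed
  have R_mono: "R p" if "R p'" "p \<le> p'" for p p'
  proof -
    obtain \<delta> where \<delta>: "\<delta> > 0" "\<And>s t. s < x \<Longrightarrow> x < t \<Longrightarrow> t - s < \<delta> \<Longrightarrow> p' * (t - s) \<le> g t - g s"
      using \<open>R p'\<close> unfolding R_def by metis
    have "p * (t - s) \<le> g t - g s" if "s < x" "x < t" "t - s < \<delta>" for s t
      using \<delta>(2)[OF that] mult_right_mono[OF \<open>p \<le> p'\<close>, of "t - s"] that by linarith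
    with \<delta>(1) show ?thesis unfolding R_def by blast
  qed
  have PR: "R p \<or> P q" if "p \<in> \<rat>" "q \<in> \<rat>" "p < q" for p q
    using gap[OF that] P_iff R_iff by blast
  define A where "A = {p \<in> \<rat>. R p}"
  have "P M" "R (- M')" using up down P_iff R_iff[of "- M'"] by simp_all
  have bdd: "bdd_above A" using RP \<open>P M\<close> unfolding A_def by (intro bdd_aboveI[of _ M]) auto
  obtain p0 where "p0 \<in> \<rat>" "p0 < - M'" using Rats_dense_in_real[of "- M' - 1" "- M'"] by auto
  then have ne: "A \<noteq> {}" using R_mono[OF \<open>R (- M')\<close>, of p0] unfolding A_def by auto
  define L where "L = Sup A"
  have "\<exists>\<delta>>0. \<forall>y. norm (y - x) < \<delta> \<longrightarrow> norm (g y - g x - L * (y - x)) \<le> e * norm (y - x)" if "e > 0" for e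
  proof -
    obtain p where p: "p \<in> A" "L - e < p" 
      using less_cSup_iff[OF ne bdd, of "L - e"] \<open>e > 0\<close> unfolding L_def by auto
    \<comment> \<open>A rational above \<open>L\<close> is not a lower bound for the slopes, so every larger rational is an upper bound.\<close>
    obtain p' where p': "p' \<in> \<rat>" "L < p'" "p' < L + e / 2" using Rats_dense_in_real[of L "L + e/2"] \<open>e > 0\<close> by auto
    obtain q where q: "q \<in> \<rat>" "L + e / 2 < q" "q < L + e" using Rats_dense_in_real[of "L + e/2" "L + e"] \<open>e > 0\<close> by auto
    have "p' \<notin> A" using p'(2) cSup_upper[OF _ bdd, of p'] unfolding L_def by auto
    then have "P q" using PR[OF p'(1) q(1)] p' q unfolding A_def by auto
    have "R p" using p unfolding A_def by auto
    obtain \<delta>1 \<delta>2 where \<delta>: "\<delta>1 > 0" "\<delta>2 > 0"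
      "\<And>s t. s < x \<Longrightarrow> x < t \<Longrightarrow> t - s < \<delta>1 \<Longrightarrow> p * (t - s) \<le> g t - g s"
      "\<And>s t. s < x \<Longrightarrow> x < t \<Longrightarrow> t - s < \<delta>2 \<Longrightarrow> g t - g s \<le> q * (t - s)"
      using \<open>R p\<close> \<open>P q\<close> unfolding P_def R_def by metis
    define r where "r = min \<delta>1 \<delta>2 / 2"
    have r: "r > 0" using \<delta> by (simp add: r_def)
    have main: "\<bar>g t - g s - L * (t - s)\<bar> \<le> e * (t - s)" if "s < x" "x < t" "x - r < s" "t < x + r" for s t
    proof -
      have "t - s < \<delta>1" "t - s < \<delta>2" using that by (auto simp: r_def)
      then have "p * (t - s) \<le> g t - g s" "g t - g s \<le> q * (t - s)" using \<delta> that by blast+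
      moreover have "(L - e) * (t - s) \<le> p * (t - s)" "q * (t - s) \<le> (L + e) * (t - s)"
        using p(2) q(3) that by (auto intro!: mult_right_mono)
      ultimately show ?thesis by (simp add: algebra_simps abs_le_iff)
    qed
    have right: "\<bar>g t - g x - L * (t - x)\<bar> \<le> e * (t - x)" if t: "x < t" "t < x + r" for t
    proof (rule tendsto_le)
      show "((\<lambda>s. e * (t - s)) \<longlongrightarrow> e * (t - x)) (at_left x)" by (intro tendsto_intros)
      show "((\<lambda>s. \<bar>g t - g s - L * (t - s)\<bar>) \<longlongrightarrow> \<bar>g t - g x - L * (t - x)\<bar>) (at_left x)"
        using cont by (intro tendsto_intros) (auto simp: isCont_def intro: tendsto_within_subset)
      show "\<forall>\<^sub>F s in at_left x. \<bar>g t - g s - L * (t - s)\<bar> \<le> e * (t - s)"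
        unfolding eventually_at_left_field using main t r by (intro exI[of _ "x - r"]) auto
    qed simp
    have left: "\<bar>g x - g s - L * (x - s)\<bar> \<le> e * (x - s)" if s: "s < x" "x - r < s" for s
    proof (rule tendsto_le)
      show "((\<lambda>t. e * (t - s)) \<longlongrightarrow> e * (x - s)) (at_right x)" by (intro tendsto_intros)
      show "((\<lambda>t. \<bar>g t - g s - L * (t - s)\<bar>) \<longlongrightarrow> \<bar>g x - g s - L * (x - s)\<bar>) (at_right x)"
        using cont by (intro tendsto_intros) (auto simp: isCont_def intro: tendsto_within_subset)
      show "\<forall>\<^sub>F t in at_right x. \<bar>g t - g s - L * (t - s)\<bar> \<le> e * (t - s)"
        unfolding eventually_at_right_field using main s r by (intro exI[of _ "x + r"]) auto
    qed simp
    have "norm (g y - g x - L * (y - x)) \<le> e * norm (y - x)" if "norm (y - x) < r" for y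
    proof (cases y x rule: linorder_cases)
      case less
      then have "g y - g x - L * (y - x) = - (g x - g y - L * (x - y))" by (simp add: algebra_simps)
      then show ?thesis using left[of y] less that by simp
    next
      case greater
      then show ?thesis using right[of y] that by simp
    qed simp
    with r show ?thesis by blast
  qed
  then have "(g has_derivative (\<lambda>y. L * y)) (at x)"
    unfolding has_derivative_at_alt by (auto intro: bounded_linear_mult_right)
  then show ?thesis by (auto simp: differentiable_def)
qed

theorem abs_cont_differentiable_ae:
  assumes ac: "abs_cont_on_Icc c d g"
  shows "negligible {x \<in> {c<..<d}. \<not> g differentiable (at x)}"
proof -
  let ?m = "\<lambda>x. - g x"
  let ?Q = "{(p, q). p \<in> \<rat> \<and> q \<in> \<rat> \<and> p < (q::real)}"
  let ?G = "\<Union>(p, q) \<in> ?Q. steep g c d q \<inter> steep ?m c d (- p)"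
  let ?N = "(\<Inter>n. steep g c d (real n)) \<union> (\<Inter>n. steep ?m c d (real n)) \<union> ?G"
  have "negligible ?G"
  proof (rule negligible_countable_Union)
    have "countable (\<rat> \<times> (\<rat> :: real set))" by (intro countable_SIGMA countable_rat)
    then have "countable ?Q" by (rule countable_subset[rotated]) auto
    then show "countable ((\<lambda>(p, q). steep g c d q \<inter> steep ?m c d (- p)) ` ?Q)" by (rule countable_image)
  qed (use negligible_steep_up_and_down[OF ac] in auto)
  then have neg: "negligible ?N"
    using negligible_infinitely_steep[OF ac] negligible_infinitely_steep[OF abs_cont_on_Icc_uminus[OF ac]]
    by (intro negligible_Un)
  have "g differentiable (at x)" if x: "x \<in> {c<..<d}" "x \<notin> ?N" for x
  proof -
    obtain n m where "x \<notin> steep g c d (real n)" "x \<notin> steep ?m c d (real m)" using x(2) by blast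
    moreover have "isCont g x"
      using continuous_on_abs_cont[OF ac] x(1) by (intro continuous_on_interior[of "{c..d}"]) auto
    moreover have "x \<notin> steep g c d q \<inter> steep ?m c d (- p)" if "p \<in> \<rat>" "q \<in> \<rat>" "p < q" for p q
      using x(2) that by blast
    ultimately show ?thesis using differentiable_if_not_steep[OF x(1)] by blast
  qed
  then have "{x \<in> {c<..<d}. \<not> g differentiable (at x)} \<subseteq> ?N" by blast
  with neg show ?thesis by (rule negligible_subset)
qed

section \<open>The fundamental theorem of calculus\<close>

text \<open>
  The fundamental theorem for absolutely continuous functions, with the Henstock--Kurzweil integral.
  On intervals tagged in the null set \<open>N\<close> the gauge forces the intervals into an open set of small
  measure, where absolute continuity makes the increments small; on the others the straddle
  estimate applies.
\<close>
theorem abs_cont_has_integral: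
  fixes g g' :: "real \<Rightarrow> real"
  assumes ac: "abs_cont_on_Icc c d g" and "c \<le> d" and N: "negligible N"
    and deriv: "\<And>x. x \<in> {c..d} - N \<Longrightarrow> (g has_real_derivative g' x) (at x)"
  shows "(g' has_integral (g d - g c)) {c..d}"
proof -
  define k where "k x = (if x \<in> N then 0 else g' x)" for x
  have "(k has_integral (g d - g c)) (cbox c d)"
    unfolding has_integral
  proof (intro allI impI)
    fix e :: real assume "e > 0"
    define \<epsilon> where "\<epsilon> = e / (2 * (d - c + 1))"
    have \<epsilon>: "\<epsilon> > 0" "\<epsilon> * (d - c) < e / 2" using \<open>e > 0\<close> \<open>c \<le> d\<close> by (auto simp: \<epsilon>_def field_simps)
    obtain \<delta> where "\<delta> > 0" and \<delta>: "\<And>D. D division_of \<Union>D \<Longrightarrow> \<Union>D \<subseteq> {c..d} 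
      \<Longrightarrow> sum (increment (\<lambda>x. x)) D < \<delta> \<Longrightarrow> (\<Sum>K\<in>D. \<bar>increment g K\<bar>) < e / 2"
      by (rule abs_cont_on_IccE[OF ac half_gt_zero[OF \<open>e > 0\<close>]]) (rule that)
    have N0: "N \<in> sets lebesgue"
      using N unfolding negligible_iff_null_sets by (rule null_setsD2)
    obtain U where U: "open U" "N \<subseteq> U" "emeasure lebesgue (U - N) < ennreal \<delta>"
      using sets_lebesgue_outer_open[OF N0 \<open>\<delta> > 0\<close>] by metis
    have "emeasure lebesgue (U - N \<union> N) = emeasure lebesgue (U - N)"
      using U(1) N0 N by (intro emeasure_Un_null_set) (auto simp: negligible_iff_null_sets)
    moreover have "U - N \<union> N = U" using U(2) by blast
    ultimately have U\<delta>: "emeasure lebesgue U < ennreal \<delta>" using U(3) by simp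
    have "\<exists>r>0. (x \<in> N \<longrightarrow> ball x r \<subseteq> U) \<and>
        (x \<in> {c..d} - N \<longrightarrow> (\<forall>u v. u \<le> x \<and> x \<le> v \<and> {u..v} \<subseteq> ball x r \<longrightarrow> \<bar>g v - g u - g' x * (v - u)\<bar> \<le> \<epsilon> * (v - u)))" for x
    proof (cases "x \<in> N")
      case True
      then show ?thesis using U by (auto simp: subset_eq elim!: openE) 
    next
      case False
      show ?thesis
      proof (cases "x \<in> {c..d}")
        case True
        with False have "(g has_derivative (\<lambda>y. g' x * y)) (at x)"
          using deriv[of x] by (simp add: has_field_derivative_def)
        then obtain r where r: "r > 0" "\<And>y. norm (y - x) < r \<Longrightarrow> norm (g y - g x - g' x * (y - x)) \<le> \<epsilon> * norm (y - x)"
          using \<epsilon>(1) unfolding has_derivative_at_alt by blast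
        have "\<bar>g v - g u - g' x * (v - u)\<bar> \<le> \<epsilon> * (v - u)" if uv: "u \<le> x" "x \<le> v" "{u..v} \<subseteq> ball x r" for u v
        proof -
          have "u \<in> ball x r" "v \<in> ball x r" using uv(1,2) by (intro subsetD[OF uv(3)]; simp)+
          then have "\<bar>g v - g x - g' x * (v - x)\<bar> \<le> \<epsilon> * (v - x)" "\<bar>g u - g x - g' x * (u - x)\<bar> \<le> \<epsilon> * (x - u)"
            using r(2)[of v] r(2)[of u] uv(1,2) by (auto simp: dist_real_def)
          moreover have "g v - g u - g' x * (v - u) = (g v - g x - g' x * (v - x)) - (g u - g x - g' x * (u - x))"
            "\<epsilon> * (v - u) = \<epsilon> * (v - x) + \<epsilon> * (x - u)"
            by (simp_all add: algebra_simps)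
          ultimately show ?thesis by linarith
        qed
        with r(1) False show ?thesis by blast
      qed (use False in \<open>auto intro: exI[of _ 1]\<close>)
    qed
    then obtain r where r: "\<And>x. r x > 0" "\<And>x. x \<in> N \<Longrightarrow> ball x (r x) \<subseteq> U"
      "\<And>x u v. x \<in> {c..d} - N \<Longrightarrow> u \<le> x \<Longrightarrow> x \<le> v \<Longrightarrow> {u..v} \<subseteq> ball x (r x) \<Longrightarrow> \<bar>g v - g u - g' x * (v - u)\<bar> \<le> \<epsilon> * (v - u)"
      by metis
    show "\<exists>\<gamma>. gauge \<gamma> \<and> (\<forall>\<D>. \<D> tagged_division_of cbox c d \<and> \<gamma> fine \<D> \<longrightarrow>
        norm ((\<Sum>(x, K)\<in>\<D>. measure lborel K *\<^sub>R k x) - (g d - g c)) < e)"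
    proof (intro exI[of _ "\<lambda>x. ball x (r x)"] conjI allI impI)
      show "gauge (\<lambda>x. ball x (r x))" using r(1) by (simp add: gauge_def)
      fix p assume "p tagged_division_of cbox c d \<and> (\<lambda>x. ball x (r x)) fine p"
      then have p: "p tagged_division_of {c..d}" and fine: "\<And>x K. (x, K) \<in> p \<Longrightarrow> K \<subseteq> ball x (r x)"
        by (auto simp: cbox_interval dest: fineD)
      have finp: "finite p" using p by auto
      have mem: "\<exists>u v. K = {u..v} \<and> u \<le> x \<and> x \<le> v \<and> x \<in> {c..d}" if "(x, K) \<in> p" for x K
        using tagged_division_ofD(2,3,4)[OF p that] by (auto simp: cbox_interval)
      define p1 where "p1 = {xK \<in> p. fst xK \<in> N}"
      have p1: "p1 \<subseteq> p" by (auto simp: p1_def)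
      have p1': "p1 tagged_partial_division_of {c..d}"
        using p p1 by (meson tagged_division_of_def tagged_partial_division_subset)
      have div1: "snd ` p1 division_of \<Union>(snd ` p1)" by (rule partial_division_of_tagged_division[OF p1'])
      have sub1: "\<Union>(snd ` p1) \<subseteq> U" "\<Union>(snd ` p1) \<subseteq> {c..d}"
        using fine r(2) p1 tagged_division_ofD(3)[OF p] unfolding p1_def by fastforce+
      have "emeasure lebesgue (\<Union>(snd ` p1)) \<le> emeasure lebesgue U"
        using sub1(1) U(1) by (intro emeasure_mono) auto
      then have "emeasure lebesgue (\<Union>(snd ` p1)) < ennreal \<delta>" using U\<delta> by (rule order.strict_trans1)
      then have "measure lebesgue (\<Union>(snd ` p1)) < \<delta>"
        using lmeasurable_division[OF div1] by (simp add: emeasure_eq_measure2 ennreal_less_iff)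
      then have "(\<Sum>K\<in>snd ` p1. \<bar>increment g K\<bar>) < e / 2"
        using \<delta>[OF div1 sub1(2)] sum_increment_id_eq_measure[OF div1] by simp
      moreover have "(\<Sum>(x, K)\<in>p1. \<bar>increment g K\<bar>) = (\<Sum>K\<in>snd ` p1. \<bar>increment g K\<bar>)"
      proof -
        have ne: "K \<noteq> {}" if "(x, K) \<in> p1" for x K
          using tagged_division_ofD(2)[OF p, of x K] p1 that by blast
        \<comment> \<open>Sums over tagged divisions reduce to sums over the intervals for functions that vanish on
          all degenerate boxes, the empty one included, where the increment need not vanish.\<close>
        let ?k = "\<lambda>K. if K = {} then 0 else \<bar>increment g K\<bar>"
        have "(\<Sum>(x, K)\<in>p1. \<bar>increment g K\<bar>) = (\<Sum>(x, K)\<in>p1. ?k K)"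
          using ne by (intro sum.cong) auto
        also have "\<dots> = (\<Sum>K\<in>snd ` p1. ?k K)"
        proof (rule sum.over_tagged_division_lemma[OF tagged_partial_division_of_Union_self[OF p1']])
          fix u v :: real assume "box u v = {}" 
          then show "?k (cbox u v) = 0" 
            by (cases "u = v") (auto simp: increment_def box_real)
        qed
        also have "\<dots> = (\<Sum>K\<in>snd ` p1. \<bar>increment g K\<bar>)"
          using div1 by (intro sum.cong) (auto dest: division_ofD(3))
        finally show ?thesis .
      qed
      ultimately have s1: "(\<Sum>(x, K)\<in>p1. \<bar>increment g K\<bar>) < e / 2" by simp
      have s2: "(\<Sum>(x, K)\<in>p - p1. \<bar>increment g K - measure lborel K * k x\<bar>) \<le> \<epsilon> * (d - c)"
      proof -
        have "(\<Sum>(x, K)\<in>p - p1. \<bar>increment g K - measure lborel K * k x\<bar>) \<le> (\<Sum>(x, K)\<in>p - p1. \<epsilon> * measure lborel K)"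
        proof (rule sum_mono, clarify)
          fix x K assume xK: "(x, K) \<in> p" "(x, K) \<notin> p1"
          then have "x \<notin> N" by (auto simp: p1_def)
          obtain u v where uv: "K = {u..v}" "u \<le> x" "x \<le> v" "x \<in> {c..d}" using mem[OF xK(1)] by blast
          then show "\<bar>increment g K - measure lborel K * k x\<bar> \<le> \<epsilon> * measure lborel K"
            using r(3)[of x u v] fine[OF xK(1)] \<open>x \<notin> N\<close> by (simp add: k_def mult.commute)
        qed
        also have "\<dots> \<le> (\<Sum>(x, K)\<in>p. \<epsilon> * measure lborel K)"
          using \<epsilon>(1) finp by (intro sum_mono2) auto
        also have "\<dots> = \<epsilon> * (\<Sum>(x, K)\<in>p. measure lborel K)" by (simp add: sum_distrib_left split_def)
        also have "(\<Sum>(x, K)\<in>p. measure lborel K) = d - c"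
          using additive_content_tagged_division[of p c d] p \<open>c \<le> d\<close> by (simp add: cbox_interval)
        finally show ?thesis .
      qed
      have "(\<Sum>(x, K)\<in>p. measure lborel K *\<^sub>R k x) - (g d - g c) = (\<Sum>(x, K)\<in>p. measure lborel K * k x - increment g K)"
        using increment_tagged_division[OF p \<open>c \<le> d\<close>, of g] by (simp add: sum_subtractf split_def)
      also have "\<bar>\<dots>\<bar> \<le> (\<Sum>(x, K)\<in>p. \<bar>increment g K - measure lborel K * k x\<bar>)"
        by (rule order_trans[OF sum_abs]) (simp add: split_def abs_minus_commute)
      also have "\<dots> = (\<Sum>(x, K)\<in>p1. \<bar>increment g K - measure lborel K * k x\<bar>) + (\<Sum>(x, K)\<in>p - p1. \<bar>increment g K - measure lborel K * k x\<bar>)"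
        using sum.subset_diff[OF p1 finp] by (simp add: add.commute)
      also have "(\<Sum>(x, K)\<in>p1. \<bar>increment g K - measure lborel K * k x\<bar>) = (\<Sum>(x, K)\<in>p1. \<bar>increment g K\<bar>)"
        by (intro sum.cong) (auto simp: p1_def k_def)
      finally show "norm ((\<Sum>(x, K)\<in>p. measure lborel K *\<^sub>R k x) - (g d - g c)) < e"
        using s1 s2 \<epsilon>(2) by (simp add: real_norm_def)
    qed
  qed
  then have "(k has_integral (g d - g c)) {c..d}" by (simp add: cbox_interval)
  then show ?thesis
    by (rule has_integral_spike[OF N, rotated]) (simp add: k_def)
qed

section \<open>The pointwise inequality\<close>

text \<open>
  The derivative of \<open>signed_power p\<close> divided by \<open>p - 1\<close>. The case \<open>p = 2\<close> is separate because
  \<open>0 powr 0 = 0\<close>, while the derivative of the identity at \<open>0\<close> is \<open>1\<close>.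
\<close>
definition power_weight :: "real \<Rightarrow> real \<Rightarrow> real" where
  "power_weight p s = (if p = 2 then 1 else \<bar>s\<bar> powr (p - 2))"

text \<open>
  The map \<open>s \<mapsto> \<bar>s\<bar>\<^sup>p\<^sup>-\<^sup>2 s\<close>, equal to the identity for \<open>p = 2\<close>.
\<close>
definition signed_power :: "real \<Rightarrow> real \<Rightarrow> real" where
  "signed_power p s = \<bar>s\<bar> powr (p - 2) * s"

lemma signed_power_mult_self: "signed_power p s * s = \<bar>s\<bar> powr p"
proof (cases "s = 0")
  case False
  have "\<bar>s\<bar> powr p = \<bar>s\<bar> powr (p - 2) * \<bar>s\<bar> powr 2"
    by (simp only: powr_add[symmetric]) simp
  also have "\<bar>s\<bar> powr 2 = s * s" using False by (simp add: powr_numeral power2_eq_square)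
  finally show ?thesis by (simp add: signed_power_def)
qed (simp add: signed_power_def)

lemma signed_power_has_real_derivative:
  assumes "p \<ge> 2"
  shows "(signed_power p has_real_derivative (p - 1) * power_weight p s) (at s)"
proof (cases "p = 2")
  case True
  have "signed_power p = (\<lambda>s. s)" by (auto simp: signed_power_def True fun_eq_iff)
  then show ?thesis using True by (simp add: power_weight_def)
next
  case False
  with assms have p: "p > 2" by simp
  have pow: "t * t powr (p - 2) = t powr (p - 1)" if "t > 0" for t :: real
    using that powr_mult_base[of t "p - 2"] by (simp add: algebra_simps)
  consider "s > 0" | "s < 0" | "s = 0" by linarith
  then show ?thesis
  proof cases
    case 1
    have "((\<lambda>s. s powr (p - 1)) has_real_derivative (p - 1) * s powr (p - 1 - 1)) (at s)"
      using 1 by (auto intro!: derivative_eq_intros)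
    then have "((\<lambda>s. s powr (p - 1)) has_real_derivative (p - 1) * power_weight p s) (at s)"
      using 1 False by (simp add: power_weight_def)
    then show ?thesis
    proof (rule has_field_derivative_transform_within_open[where S = "{0<..}"])
      show "x powr (p - 1) = signed_power p x" if "x \<in> {0<..}" for x
        using that pow[of x] by (simp add: signed_power_def mult.commute)
    qed (use 1 in auto)
  next
    case 2
    have "((\<lambda>s. - ((- s) powr (p - 1))) has_real_derivative (p - 1) * (- s) powr (p - 1 - 1)) (at s)"
      using 2 by (auto intro!: derivative_eq_intros)
    then have "((\<lambda>s. - ((- s) powr (p - 1))) has_real_derivative (p - 1) * power_weight p s) (at s)"
      using 2 False by (simp add: power_weight_def)
    then show ?thesis
    proof (rule has_field_derivative_transform_within_open[where S = "{..<0}"])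
      show "- ((- x) powr (p - 1)) = signed_power p x" if "x \<in> {..<0}" for x
        using that pow[of "- x"] by (simp add: signed_power_def mult.commute)
    qed (use 2 in auto)
  next
    case 3
    have "((\<lambda>t. \<bar>t\<bar> powr (p - 2)) \<longlongrightarrow> 0) (at (0::real))"
    proof (rule tendsto_zero_powrI[where b = "p - 2"])
      show "((\<lambda>t. \<bar>t\<bar>) \<longlongrightarrow> 0) (at (0::real))" by (intro tendsto_rabs_zero tendsto_ident_at)
    qed (use p in auto)
    then have "((\<lambda>t. signed_power p t / t) \<longlongrightarrow> 0) (at 0)"
      by (rule Lim_transform_eventually) (auto simp: eventually_at signed_power_def intro!: exI[of _ 1])
    then show ?thesis
      using 3 False by (simp add: has_field_derivative_iff signed_power_def power_weight_def)
  qed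
qed

lemma continuous_on_signed_power: "p \<ge> 2 \<Longrightarrow> continuous_on A (signed_power p)"
  by (meson DERIV_isCont continuous_at_imp_continuous_on signed_power_has_real_derivative)

lemma signed_power_lipschitz:
  assumes "p \<ge> 2" "\<bar>x\<bar> \<le> M" "\<bar>y\<bar> \<le> M"
  shows "\<bar>signed_power p x - signed_power p y\<bar> \<le> (p - 1) * power_weight p M * \<bar>x - y\<bar>"
proof -
  have "norm (signed_power p x - signed_power p y) \<le> (p - 1) * power_weight p M * norm (x - y)"
  proof (rule field_differentiable_bound[where S = "{-M..M}" and f' = "\<lambda>s. (p - 1) * power_weight p s"])
    show "(signed_power p has_field_derivative (p - 1) * power_weight p z) (at z within {-M..M})" for z
      using signed_power_has_real_derivative[OF assms(1)] by (rule has_field_derivative_at_within)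
    show "norm ((p - 1) * power_weight p z) \<le> (p - 1) * power_weight p M" if "z \<in> {-M..M}" for z
      using that assms(1) by (auto simp: power_weight_def abs_mult intro!: mult_left_mono powr_mono2)
  qed (use assms in auto)
  then show ?thesis by simp
qed

text \<open>
  Young's inequality with exponents \<open>p / (p - 2)\<close> and \<open>p / 2\<close>. It replaces the Hoelder inequality
  and gives the same constant, with nothing to divide by afterwards.
\<close>
lemma young_power_weight:
  assumes p: "p \<ge> 2" and Y: "Y \<ge> (0::real)"
  shows "p / 2 * (power_weight p s * Y) \<le> (p / 2 - 1) * \<bar>s\<bar> powr p + Y powr (p / 2)"
proof (cases "p = 2")
  case True
  then show ?thesis using Y by (simp add: power_weight_def)
next
  case False
  with p have p: "p > 2" by simp
  have "\<bar>s\<bar> powr (p - 2) * Y \<le> (\<bar>s\<bar> powr (p - 2)) powr (p / (p - 2)) / (p / (p - 2)) + Y powr (p / 2) / (p / 2)"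
    using p Y by (intro Youngs_inequality) (auto simp: field_simps)
  also have "(\<bar>s\<bar> powr (p - 2)) powr (p / (p - 2)) = \<bar>s\<bar> powr p" using p by (simp add: powr_powr)
  finally have "p / 2 * (\<bar>s\<bar> powr (p - 2) * Y) \<le> p / 2 * (\<bar>s\<bar> powr p / (p / (p - 2)) + Y powr (p / 2) / (p / 2))"
    using p by (intro mult_left_mono) auto
  also have "\<dots> = (p / 2 - 1) * \<bar>s\<bar> powr p + Y powr (p / 2)" using p by (simp add: field_simps)
  finally show ?thesis using False by (simp add: power_weight_def)
qed

text \<open>
  With \<open>s = f'\<close>, \<open>s' = f''\<close>, \<open>hy = h (f)\<close> and \<open>Hy = H (f)\<close>, the last bracket is, almost
  everywhere, the derivative of the flux \<open>signed_power p (f') * H (f)\<close>.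
\<close>
lemma integrand_le_derivative:
  assumes p: "p \<ge> 2" and "hy > 0"
  shows "\<bar>s\<bar> powr p * hy \<le> (p - 1) powr (p / 2) * (\<bar>s' * (Hy / hy)\<bar> powr (p / 2) * hy)
    + p / 2 * ((p - 1) * power_weight p s * s' * Hy + signed_power p s * (hy * s))"
proof -
  define T where "T = Hy / hy"
  have Hy: "Hy = T * hy" using \<open>hy > 0\<close> by (simp add: T_def)
  define Y where "Y = (p - 1) * \<bar>s' * T\<bar>"
  have "Y \<ge> 0" using p by (simp add: Y_def)
  have Yp: "Y powr (p / 2) = (p - 1) powr (p / 2) * \<bar>s' * T\<bar> powr (p / 2)"
    using p by (simp add: Y_def powr_mult)
  have w: "power_weight p s \<ge> 0" by (simp add: power_weight_def)
  have "- (power_weight p s * Y) \<le> power_weight p s * ((p - 1) * (s' * T))"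
  proof -
    have "- Y \<le> (p - 1) * (s' * T)" 
      using mult_left_mono[of "- \<bar>s' * T\<bar>" "s' * T" "p - 1"] p by (simp add: Y_def)
    from mult_left_mono[OF this w] show ?thesis by simp
  qed
  then have "- (p / 2 * (power_weight p s * Y)) \<le> p / 2 * (power_weight p s * ((p - 1) * (s' * T)))"
    using mult_left_mono[of _ _ "p / 2"] p by fastforce
  with young_power_weight[OF p \<open>Y \<ge> 0\<close>, of s]
  have "\<bar>s\<bar> powr p \<le> Y powr (p / 2) + p / 2 * (power_weight p s * ((p - 1) * (s' * T)) + \<bar>s\<bar> powr p)"
    by (simp add: algebra_simps)
  then have "\<bar>s\<bar> powr p * hy \<le> (Y powr (p / 2) + p / 2 * (power_weight p s * ((p - 1) * (s' * T)) + \<bar>s\<bar> powr p)) * hy"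
    using \<open>hy > 0\<close> by (intro mult_right_mono) auto
  also have "\<dots> = (p - 1) powr (p / 2) * (\<bar>s' * T\<bar> powr (p / 2) * hy)
    + p / 2 * ((p - 1) * power_weight p s * s' * Hy + signed_power p s * (hy * s))"
    unfolding Yp Hy signed_power_mult_self[of p s, symmetric] by (simp add: algebra_simps)
  finally show ?thesis unfolding T_def .
qed

section \<open>The inequality on a compact interval where the function is positive\<close>

lemma abs_cont_on_Icc_lipschitz:
  assumes ac: "abs_cont_on_Icc c d g"
    and lip: "\<And>s t. c \<le> s \<Longrightarrow> s \<le> t \<Longrightarrow> t \<le> d \<Longrightarrow> \<bar>u t - u s\<bar> \<le> M * (\<bar>g t - g s\<bar> + (t - s))"
  shows "abs_cont_on_Icc c d u"
  unfolding abs_cont_on_Icc_increment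
proof (intro allI impI)
  fix e :: real assume "e > 0"
  define m where "m = \<bar>M\<bar> + 1"
  have m: "m > 0" "M \<le> m" by (auto simp: m_def)
  have "e / (2 * m) > 0" using \<open>e > 0\<close> m by simp
  then obtain \<delta> where "\<delta> > 0" and \<delta>: "\<And>D. D division_of \<Union>D \<Longrightarrow> \<Union>D \<subseteq> {c..d} 
      \<Longrightarrow> sum (increment (\<lambda>x. x)) D < \<delta> \<Longrightarrow> (\<Sum>K\<in>D. \<bar>increment g K\<bar>) < e / (2 * m)"
    by (rule abs_cont_on_IccE[OF ac]) (rule that)
  show "\<exists>\<delta>>0. \<forall>D. D division_of \<Union>D \<and> \<Union>D \<subseteq> {c..d} \<and> sum (increment (\<lambda>x. x)) D < \<delta> \<longrightarrow> (\<Sum>K\<in>D. \<bar>increment u K\<bar>) < e"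
  proof (intro exI[of _ "min \<delta> (e / (2 * m))"] conjI allI impI)
    fix D assume "D division_of \<Union>D \<and> \<Union>D \<subseteq> {c..d} \<and> sum (increment (\<lambda>x. x)) D < min \<delta> (e / (2 * m))"
    then have D: "D division_of \<Union>D" "\<Union>D \<subseteq> {c..d}" 
      and small: "sum (increment (\<lambda>x. x)) D < \<delta>" "sum (increment (\<lambda>x. x)) D < e / (2 * m)" by auto
    have "(\<Sum>K\<in>D. \<bar>increment u K\<bar>) \<le> (\<Sum>K\<in>D. m * (\<bar>increment g K\<bar> + increment (\<lambda>x. x) K))"
    proof (rule sum_mono)
      fix K assume K: "K \<in> D"
      obtain s t where st: "s \<le> t" "K = {s..t}" using division_of_real_member[OF D(1) K] .
      then have "{s..t} \<subseteq> {c..d}" using D(2) K by blast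
      then have "c \<le> s" "t \<le> d" using st by auto
      then have "\<bar>u t - u s\<bar> \<le> M * (\<bar>g t - g s\<bar> + (t - s))" using lip st by blast
      also have "\<dots> \<le> m * (\<bar>g t - g s\<bar> + (t - s))" using m st by (intro mult_right_mono) auto
      finally show "\<bar>increment u K\<bar> \<le> m * (\<bar>increment g K\<bar> + increment (\<lambda>x. x) K)" using st by simp
    qed
    also have "\<dots> = m * ((\<Sum>K\<in>D. \<bar>increment g K\<bar>) + sum (increment (\<lambda>x. x)) D)"
      by (simp only: sum_distrib_left[symmetric] sum.distrib)
    also have "\<dots> < m * (e / (2 * m) + e / (2 * m))"
      using \<delta>[OF D small(1)] small(2) m by (intro mult_strict_left_mono add_strict_mono) auto
    also have "\<dots> = e" using m by simp
    finally show "(\<Sum>K\<in>D. \<bar>increment u K\<bar>) < e" .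
  qed (use \<open>\<delta> > 0\<close> \<open>e / (2 * m) > 0\<close> in simp)
qed

text \<open>
  A locally absolutely continuous primitive of a continuous function is an integral of it, and is
  therefore differentiable at every point.
\<close>
lemma primitive_of_continuous_has_real_derivative:
  assumes h: "continuous_on {0<..} h" and ac: "locally_abs_cont_on {0<..} H"
    and ae: "AE y in lborel. y > 0 \<longrightarrow> (H has_real_derivative h y) (at y)"
    and "y > 0"
  shows "(H has_real_derivative h y) (at y)"
proof -
  let ?c = "y / 2"
  obtain N where N: "N \<in> null_sets lborel" "{y. \<not> (y > 0 \<longrightarrow> (H has_real_derivative h y) (at y))} \<subseteq> N"
    using ae by (auto simp: eventually_ae_filter)
  have negl: "negligible N" using N(1) by (simp add: negligible_iff_null_sets null_sets_completionI)
  have int: "(h has_integral (H z - H ?c)) {?c..z}" if "?c \<le> z" for z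
  proof (rule abs_cont_has_integral[OF _ that negl])
    show "abs_cont_on_Icc ?c z H" 
      using ac \<open>y > 0\<close> unfolding locally_abs_cont_on_def by (elim allE[of _ ?c] allE[of _ z]) auto
    show "(H has_real_derivative h x) (at x)" if "x \<in> {?c..z} - N" for x
    proof -
      have "x > 0" using that \<open>y > 0\<close> by auto
      with that N(2) show ?thesis by blast
    qed
  qed
  have cont: "continuous_on {?c..2*y} h" using h \<open>y > 0\<close> by (auto intro: continuous_on_subset)
  have "((\<lambda>z. integral {?c..z} h) has_real_derivative h y) (at y within {?c..2*y})"
    using integral_has_real_derivative[OF cont, of y] \<open>y > 0\<close> by simp
  then have "((\<lambda>z. integral {?c..z} h) has_real_derivative h y) (at y)"
    using \<open>y > 0\<close> at_within_interior[of y "{?c..2*y}"] by simp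
  then have "((\<lambda>z. H ?c + integral {?c..z} h) has_real_derivative h y) (at y)"
    using DERIV_add[OF DERIV_const[of "H ?c"]] by fastforce
  then show ?thesis
  proof (rule has_field_derivative_transform_within_open[where S = "{?c<..}"])
    show "H ?c + integral {?c..z} h = H z" if "z \<in> {?c<..}" for z
      using integral_unique[OF int, of z] that by simp
  qed (use \<open>y > 0\<close> in auto)
qed

text \<open>
  The flux \<open>signed_power p (f') * H (f)\<close> is absolutely continuous, because \<open>f'\<close> is and the other
  ingredients are Lipschitz on the compact ranges that occur.
\<close>
lemma flux_has_integral:
  fixes f h H :: "real \<Rightarrow> real"
  assumes p: "p \<ge> 2" and "r < R"
    and f: "\<And>x. x \<in> {r..R} \<Longrightarrow> f differentiable (at x)"
    and ac: "abs_cont_on_Icc r R (deriv f)"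
    and pos: "\<And>x. x \<in> {r..R} \<Longrightarrow> f x > 0"
    and h: "continuous_on {0<..} h"
    and H: "\<And>y. y > 0 \<Longrightarrow> (H has_real_derivative h y) (at y)"
  shows "((\<lambda>x. (p - 1) * power_weight p (deriv f x) * deriv (deriv f) x * H (f x)
            + signed_power p (deriv f x) * (h (f x) * deriv f x)) has_integral
          (signed_power p (deriv f R) * H (f R) - signed_power p (deriv f r) * H (f r))) {r..R}" (is ?int)
    and "(deriv (deriv f) has_integral (deriv f R - deriv f r)) {r..R}"
proof -
  let ?g = "deriv f"
  have g: "(f has_real_derivative ?g x) (at x)" if "x \<in> {r..R}" for x
    using f[OF that] by (metis DERIV_deriv_iff_real_differentiable)
  have contf: "continuous_on {r..R} f"
    by (rule DERIV_continuous_on) (rule has_field_derivative_at_within[OF g])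
  have contg: "continuous_on {r..R} ?g" using ac by (rule continuous_on_abs_cont)
  have Hf: "((\<lambda>x. H (f x)) has_real_derivative h (f x) * ?g x) (at x)" if "x \<in> {r..R}" for x
    using DERIV_chain2[OF H[OF pos[OF that]] g[OF that]] .
  have contHf: "continuous_on {r..R} (\<lambda>x. H (f x))"
    by (rule DERIV_continuous_on) (rule has_field_derivative_at_within[OF Hf])
  have conth: "continuous_on {r..R} (\<lambda>x. h (f x))"
    using pos by (intro continuous_on_compose2[OF h contf]) auto
  have bnd: "\<exists>B. \<forall>x\<in>{r..R}. \<bar>k x\<bar> \<le> B" if k: "continuous_on {r..R} k" for k :: "real \<Rightarrow> real"
  proof -
    obtain B where "\<forall>y\<in>k ` {r..R}. norm y \<le> B"
      using compact_imp_bounded[OF compact_continuous_image[OF k compact_Icc]] unfolding bounded_iff by blast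
    then show ?thesis by (intro exI[of _ B]) simp
  qed
  obtain M where M: "\<And>x. x \<in> {r..R} \<Longrightarrow> \<bar>?g x\<bar> \<le> M" using bnd[OF contg] by blast
  obtain B1 where B1: "\<And>x. x \<in> {r..R} \<Longrightarrow> \<bar>H (f x)\<bar> \<le> B1" using bnd[OF contHf] by blast
  have "continuous_on {r..R} (\<lambda>x. signed_power p (?g x))"
    by (rule continuous_on_compose2[OF continuous_on_signed_power[OF p] contg]) auto
  then obtain B2 where B2: "\<And>x. x \<in> {r..R} \<Longrightarrow> \<bar>signed_power p (?g x)\<bar> \<le> B2" using bnd by blast
  obtain B3 where B3: "\<And>x. x \<in> {r..R} \<Longrightarrow> \<bar>h (f x) * ?g x\<bar> \<le> B3"
    using bnd[OF continuous_on_mult[OF conth contg]] by blast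
  have nn: "B1 \<ge> 0" "B2 \<ge> 0" "B3 \<ge> 0" using B1[of r] B2[of r] B3[of r] \<open>r < R\<close> by auto
  let ?L = "(p - 1) * power_weight p M"
  have L: "?L \<ge> 0" using p by (simp add: power_weight_def)
  define u where "u x = signed_power p (?g x) * H (f x)" for x
  have acu: "abs_cont_on_Icc r R u"
  proof (rule abs_cont_on_Icc_lipschitz[OF ac])
    fix s t assume st: "r \<le> s" "s \<le> t" "t \<le> R"
    have eq: "u t - u s = (signed_power p (?g t) - signed_power p (?g s)) * H (f t) + signed_power p (?g s) * (H (f t) - H (f s))"
      by (simp add: u_def algebra_simps)
    have 1: "\<bar>signed_power p (?g t) - signed_power p (?g s)\<bar> \<le> ?L * \<bar>?g t - ?g s\<bar>"
      using st M by (intro signed_power_lipschitz[OF p]) auto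
    have "norm (H (f t) - H (f s)) \<le> B3 * norm (t - s)"
    proof (rule field_differentiable_bound[where S = "{r..R}" and f' = "\<lambda>x. h (f x) * ?g x"])
      show "((\<lambda>x. H (f x)) has_field_derivative h (f x) * ?g x) (at x within {r..R})" if "x \<in> {r..R}" for x
        using Hf[OF that] by (rule has_field_derivative_at_within)
    qed (use st B3 in auto)
    then have 2: "\<bar>H (f t) - H (f s)\<bar> \<le> B3 * (t - s)" using st by simp
    have "\<bar>u t - u s\<bar> \<le> \<bar>signed_power p (?g t) - signed_power p (?g s)\<bar> * \<bar>H (f t)\<bar> + \<bar>signed_power p (?g s)\<bar> * \<bar>H (f t) - H (f s)\<bar>"
      unfolding eq by (rule order_trans[OF abs_triangle_ineq]) (simp add: abs_mult)
    also have "\<dots> \<le> (?L * \<bar>?g t - ?g s\<bar>) * B1 + B2 * (B3 * (t - s))"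
      using st 1 2 B1[of t] B2[of s] nn L by (intro add_mono mult_mono) auto
    also have "\<dots> \<le> (?L * B1 + B2 * B3) * (\<bar>?g t - ?g s\<bar> + (t - s))"
    proof -
      have *: "(L * X) * B1 + B2 * (B3 * Y) \<le> (L * B1 + B2 * B3) * (X + Y)"
        if "L \<ge> 0" "X \<ge> 0" "Y \<ge> 0" for L X Y
        using that nn mult_nonneg_nonneg[of "L * B1" Y] mult_nonneg_nonneg[of "B2 * B3" X]
        by (simp add: algebra_simps)
      show ?thesis using L st by (intro *) auto
    qed
    finally show "\<bar>u t - u s\<bar> \<le> (?L * B1 + B2 * B3) * (\<bar>?g t - ?g s\<bar> + (t - s))" .
  qed
  define N where "N = insert r (insert R {x \<in> {r<..<R}. \<not> ?g differentiable (at x)})"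
  have N: "negligible N"
    unfolding N_def negligible_insert by (rule abs_cont_differentiable_ae[OF ac])
  have g': "(?g has_real_derivative deriv ?g x) (at x)" if "x \<in> {r..R} - N" for x
    using that unfolding N_def by (auto simp: DERIV_deriv_iff_real_differentiable)
  then show "(deriv ?g has_integral (?g R - ?g r)) {r..R}"
    using \<open>r < R\<close> by (intro abs_cont_has_integral[OF ac _ N]) auto
  have "((\<lambda>x. (p - 1) * power_weight p (?g x) * deriv ?g x * H (f x)
            + signed_power p (?g x) * (h (f x) * ?g x)) has_integral (u R - u r)) {r..R}"
  proof (rule abs_cont_has_integral[OF acu _ N])
    fix x assume x: "x \<in> {r..R} - N"
    have *: "((\<lambda>x. signed_power p (?g x)) has_real_derivative (p - 1) * power_weight p (?g x) * deriv ?g x) (at x)"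
      using DERIV_chain2[OF signed_power_has_real_derivative[OF p] g'[OF x]] .
    have "x \<in> {r..R}" using x by blast
    from DERIV_mult[OF * Hf[OF this]]
    show "(u has_real_derivative (p - 1) * power_weight p (?g x) * deriv ?g x * H (f x)
            + signed_power p (?g x) * (h (f x) * ?g x)) (at x)"
      unfolding u_def by (simp only: mult.commute[of _ "signed_power p (?g x)"])
  qed (use \<open>r < R\<close> in simp)
  then show ?int unfolding u_def .
qed

text \<open>
  The measurability of \<open>f''\<close> comes for free from its Henstock--Kurzweil integrability.
\<close>
lemma borel_measurable_weighted_second_derivative:
  fixes f h T :: "real \<Rightarrow> real"
  assumes int: "(deriv (deriv f) has_integral I) {r..R}"
    and T: "continuous_on {r..R} (\<lambda>x. T (f x))" and h: "continuous_on {r..R} (\<lambda>x. h (f x))"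
  shows "(\<lambda>x. \<bar>deriv (deriv f) x * T (f x)\<bar> powr q * h (f x) * indicat_real {r..R} x) \<in> borel_measurable lebesgue"
proof -
  let ?i = "indicat_real {r..R}"
  have 1: "(\<lambda>x. deriv (deriv f) x * ?i x) \<in> borel_measurable lebesgue"
    using has_integral_implies_lebesgue_measurable_real[OF int] .
  have 2: "(\<lambda>x. ?i x *\<^sub>R T (f x)) \<in> borel_measurable lebesgue" "(\<lambda>x. ?i x *\<^sub>R h (f x)) \<in> borel_measurable lebesgue"
    using borel_measurable_continuous_on_indicator[OF _ T] borel_measurable_continuous_on_indicator[OF _ h]
    by (auto intro: measurable_completion)
  have "(\<lambda>x. \<bar>deriv (deriv f) x * ?i x * (?i x *\<^sub>R T (f x))\<bar> powr q * (?i x *\<^sub>R h (f x))) \<in> borel_measurable lebesgue"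
    using 1 2 by measurable
  moreover have eq: "\<bar>deriv (deriv f) x * ?i x * (?i x *\<^sub>R T (f x))\<bar> powr q * (?i x *\<^sub>R h (f x))
      = \<bar>deriv (deriv f) x * T (f x)\<bar> powr q * h (f x) * ?i x" for x
    by (simp add: indicator_def)
  ultimately show ?thesis unfolding eq by blast
qed

text \<open>
  The pointwise inequality integrated over a compact interval. The last term bounds the boundary
  contribution \<open>p / 2\<close> times the difference of the flux at the ends, each of which has the
  favourable sign up to \<open>\<epsilon>\<close>.
\<close>
lemma energy_le_on_Icc:
  fixes f h H :: "real \<Rightarrow> real"
  assumes p: "p \<ge> 2" and "r < R"
    and f: "\<And>x. x \<in> {r..R} \<Longrightarrow> f differentiable (at x)"
    and ac: "abs_cont_on_Icc r R (deriv f)"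
    and pos: "\<And>x. x \<in> {r..R} \<Longrightarrow> f x > 0"
    and h: "continuous_on {0<..} h" and hpos: "\<And>y. y > 0 \<Longrightarrow> h y > 0"
    and H: "\<And>y. y > 0 \<Longrightarrow> (H has_real_derivative h y) (at y)"
  defines "B \<equiv> \<lambda>x. \<bar>deriv (deriv f) x * T_transform H h (f x)\<bar> powr (p / 2) * h (f x)"
  shows "(\<lambda>x. B x * indicat_real {r..R} x) \<in> borel_measurable lebesgue"
    and "\<epsilon> \<ge> 0 \<Longrightarrow> signed_power p (deriv f R) * H (f R) \<le> \<epsilon> \<Longrightarrow> - \<epsilon> \<le> signed_power p (deriv f r) * H (f r) \<Longrightarrow>
      (\<integral>\<^sup>+x\<in>{r..R}. ennreal (\<bar>deriv f x\<bar> powr p * h (f x)) \<partial>lborel)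
        \<le> ennreal ((p - 1) powr (p / 2)) * (\<integral>\<^sup>+x\<in>{r..R}. ennreal (B x) \<partial>lborel) + ennreal (p * \<epsilon>)"
proof -
  let ?g = "deriv f" and ?C = "(p - 1) powr (p / 2)"
  have contf: "continuous_on {r..R} f"
    using f by (meson continuous_at_imp_continuous_on differentiable_imp_continuous_within)
  have contg: "continuous_on {r..R} ?g" using ac by (rule continuous_on_abs_cont)
  have conth: "continuous_on {r..R} (\<lambda>x. h (f x))"
    using pos by (intro continuous_on_compose2[OF h contf]) auto
  have contH: "continuous_on {r..R} (\<lambda>x. H (f x))"
  proof (rule continuous_on_compose2[OF _ contf])
    show "continuous_on {0<..} H"
      using H by (meson DERIV_isCont continuous_at_imp_continuous_on greaterThan_iff)
  qed (use pos in auto)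
  have contT: "continuous_on {r..R} (\<lambda>x. T_transform H h (f x))"
    unfolding T_transform_def using contH conth
  proof (rule continuous_on_divide)
    show "\<forall>x\<in>{r..R}. h (f x) \<noteq> 0" using hpos[OF pos] by (metis less_irrefl)
  qed
  note flux = flux_has_integral[OF p \<open>r < R\<close> f ac pos h H]
  show meas: "(\<lambda>x. B x * indicat_real {r..R} x) \<in> borel_measurable lebesgue"
    unfolding B_def by (rule borel_measurable_weighted_second_derivative[OF flux(2) contT conth])
  have Bnn: "B x \<ge> 0" if "x \<in> {r..R}" for x using hpos[OF pos[OF that]] by (simp add: B_def)
  have Cpos: "?C > 0" using p by simp
  assume \<epsilon>: "\<epsilon> \<ge> 0" and up: "signed_power p (deriv f R) * H (f R) \<le> \<epsilon>" and lo: "- \<epsilon> \<le> signed_power p (deriv f r) * H (f r)"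
  show "(\<integral>\<^sup>+x\<in>{r..R}. ennreal (\<bar>?g x\<bar> powr p * h (f x)) \<partial>lborel)
        \<le> ennreal ?C * (\<integral>\<^sup>+x\<in>{r..R}. ennreal (B x) \<partial>lborel) + ennreal (p * \<epsilon>)"
  proof (cases "(\<integral>\<^sup>+x\<in>{r..R}. ennreal (B x) \<partial>lborel) = \<infinity>")
    case True
    then show ?thesis using Cpos by (simp add: ennreal_mult_top)
  next
    case False
    have "(\<integral>\<^sup>+x. ennreal (B x * indicat_real {r..R} x) \<partial>lebesgue) < \<infinity>"
    proof -
      have "(\<integral>\<^sup>+x. ennreal (B x * indicat_real {r..R} x) \<partial>lebesgue) = (\<integral>\<^sup>+x\<in>{r..R}. ennreal (B x) \<partial>lborel)"
        unfolding nn_integral_completion by (intro nn_integral_cong) (simp add: indicator_def)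
      with False show ?thesis by (simp add: top.not_eq_extremum)
    qed
    then have "integrable lebesgue (\<lambda>x. B x * indicat_real {r..R} x)"
      using meas Bnn by (intro integrableI_nonneg) (auto simp: indicator_def)
    from has_integral_integral_lebesgue[OF this]
    obtain b where "((\<lambda>x. B x * indicat_real {r..R} x) has_integral b) UNIV" by blast
    moreover have "(\<lambda>x. B x * indicat_real {r..R} x) = (\<lambda>x. if x \<in> {r..R} then B x else 0)"
      by (auto simp: fun_eq_iff)
    ultimately have b: "(B has_integral b) {r..R}" by (simp only: has_integral_restrict_UNIV)
    have "continuous_on {r..R} (\<lambda>x. \<bar>?g x\<bar> powr p * h (f x))"
      using contg conth p by (intro continuous_on_mult continuous_on_powr' continuous_intros) auto
    then obtain A where A: "((\<lambda>x. \<bar>?g x\<bar> powr p * h (f x)) has_integral A) {r..R}"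
      using integrable_continuous_real by blast
    have "A \<le> ?C * b + p / 2 * (signed_power p (?g R) * H (f R) - signed_power p (?g r) * H (f r))"
    proof (rule has_integral_le[OF A])
      show "((\<lambda>x. ?C * B x + p / 2 * ((p - 1) * power_weight p (?g x) * deriv ?g x * H (f x)
            + signed_power p (?g x) * (h (f x) * ?g x))) has_integral 
            (?C * b + p / 2 * (signed_power p (?g R) * H (f R) - signed_power p (?g r) * H (f r)))) {r..R}"
        by (intro has_integral_add has_integral_mult_right b flux(1))
      show "\<bar>?g x\<bar> powr p * h (f x) \<le> ?C * B x + p / 2 * ((p - 1) * power_weight p (?g x) * deriv ?g x * H (f x)
            + signed_power p (?g x) * (h (f x) * ?g x))" if "x \<in> {r..R}" for x
        unfolding B_def T_transform_def using integrand_le_derivative[OF p hpos[OF pos[OF that]]] .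
    qed
    also have "\<dots> \<le> ?C * b + p / 2 * (2 * \<epsilon>)"
      using up lo p by (intro add_mono mult_left_mono) auto
    finally have Ab: "A \<le> ?C * b + p * \<epsilon>" by simp
    have b0: "b \<ge> 0" using has_integral_nonneg[OF b] Bnn by blast
    have "(\<integral>\<^sup>+x\<in>{r..R}. ennreal (\<bar>?g x\<bar> powr p * h (f x)) \<partial>lborel) = ennreal A"
      using hpos pos by (intro nn_integral_has_integral_lebesgue'[OF _ A]) (simp add: less_imp_le)
    also have "\<dots> \<le> ennreal (?C * b + p * \<epsilon>)" using Ab by (rule ennreal_leI)
    also have "\<dots> = ennreal (?C * b) + ennreal (p * \<epsilon>)"
      using \<epsilon> p b0 Cpos by (intro ennreal_plus mult_nonneg_nonneg) auto
    also have "ennreal (?C * b) = ennreal ?C * ennreal b" using b0 by (simp add: ennreal_mult)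
    also have "ennreal b = (\<integral>\<^sup>+x\<in>{r..R}. ennreal (B x) \<partial>lborel)"
      using Bnn by (intro nn_integral_has_integral_lebesgue'[OF _ b, symmetric])
    finally show ?thesis .
  qed
qed

section \<open>Decomposition of integrals over an open set into its components\<close>

lemma open_connected_eq_einterval:
  fixes K :: "real set"
  assumes "open K" "connected K" "K \<noteq> {}"
  obtains \<alpha> \<beta> :: ereal where "\<alpha> < \<beta>" "K = einterval \<alpha> \<beta>"
proof -
  define \<alpha> \<beta> where "\<alpha> = (INF x\<in>K. ereal x)" and "\<beta> = (SUP x\<in>K. ereal x)"
  have sub: "\<alpha> < ereal x \<and> ereal x < \<beta>" if x: "x \<in> K" for x
  proof -
    obtain e where e: "e > 0" "ball x e \<subseteq> K" using \<open>open K\<close> x by (meson openE)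
    have "x - e / 2 \<in> ball x e" "x + e / 2 \<in> ball x e" using e(1) by (auto simp: dist_real_def)
    with e(2) have "x - e / 2 \<in> K" "x + e / 2 \<in> K" by blast+
    then have "\<alpha> \<le> ereal (x - e / 2)" "ereal (x + e / 2) \<le> \<beta>"
      unfolding \<alpha>_def \<beta>_def by (auto intro: INF_lower SUP_upper)
    moreover have "ereal (x - e / 2) < ereal x" "ereal x < ereal (x + e / 2)" using e(1) by auto
    ultimately show ?thesis by (meson order.strict_trans1 order.strict_trans2)
  qed
  have "K = einterval \<alpha> \<beta>"
  proof (intro equalityI subsetI)
    fix x assume "x \<in> einterval \<alpha> \<beta>"
    then have "\<alpha> < ereal x" "ereal x < \<beta>" by (auto simp: einterval_def)
    then obtain y z where "y \<in> K" "ereal y < ereal x" "z \<in> K" "ereal x < ereal z"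
      unfolding \<alpha>_def \<beta>_def INF_less_iff less_SUP_iff by blast
    then show "x \<in> K" using connectedD_interval[OF \<open>connected K\<close>, of y z x] by auto
  qed (use sub in \<open>auto simp: einterval_def\<close>)
  moreover obtain x where "x \<in> K" using \<open>K \<noteq> {}\<close> by blast
  then have "\<alpha> < \<beta>" using sub[of x] by (meson less_trans)
  ultimately show thesis using that by blast
qed

lemma nn_integral_components:
  fixes F :: "real \<Rightarrow> ennreal"
  assumes "open S"
    and meas: "\<And>K. K \<in> components S \<Longrightarrow> (\<lambda>x. F x * indicator K x) \<in> borel_measurable lebesgue"
  shows "(\<integral>\<^sup>+x\<in>S. F x \<partial>lborel) = (\<integral>\<^sup>+K. (\<integral>\<^sup>+x\<in>K. F x \<partial>lborel) \<partial>count_space (components S))"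
proof -
  have count: "countable (components S)"
  proof (rule countable_disjoint_open_subsets)
    show "open K" if "K \<in> components S" for K using open_components \<open>open S\<close> that by blast
    show "disjoint (components S)" using pairwise_disjoint_components by (simp add: pairwise_def disjnt_def)
  qed
  \<comment> \<open>Written as an inner integral over the components, only one term of which is nonzero, the countable
    sum can be exchanged with the outer integral.\<close>
  have "F x * indicator S x = (\<integral>\<^sup>+K. F x * indicator K x \<partial>count_space (components S))" for x
  proof (cases "x \<in> S")
    case True
    then have "x \<in> \<Union>(components S)" by (simp only: Union_components)
    then obtain K where K: "K \<in> components S" "x \<in> K" by (rule UnionE)
    have uniq: "L = K" if "L \<in> components S" "x \<in> L" for L
      using components_nonoverlap[OF that(1) K(1)] that(2) K(2) by blast
    have "(\<integral>\<^sup>+L. F x * indicator L x \<partial>count_space (components S))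
        = (\<integral>\<^sup>+L. F x * indicator {K} L \<partial>count_space (components S))"
    proof (rule nn_integral_cong)
      fix L assume "L \<in> space (count_space (components S))"
      then have "L \<in> components S" by simp
      with uniq K(2) have "x \<in> L \<longleftrightarrow> L = K" by metis
      then show "F x * indicator L x = F x * indicator {K} L" by (simp add: indicator_def)
    qed
    also have "\<dots> = F x * emeasure (count_space (components S)) {K}"
      using K by (subst nn_integral_cmult_indicator) auto
    also have "\<dots> = F x" using K by (simp add: emeasure_count_space_finite)
    finally show ?thesis using True by simp
  next
    case False
    then have "x \<notin> K" if "K \<in> components S" for K using that in_components_subset by blast
    then have "(\<integral>\<^sup>+K. F x * indicator K x \<partial>count_space (components S)) = (\<integral>\<^sup>+K. 0 \<partial>count_space (components S))"
      by (intro nn_integral_cong) auto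
    with False show ?thesis by simp
  qed
  then have "(\<integral>\<^sup>+x\<in>S. F x \<partial>lborel) = (\<integral>\<^sup>+x. (\<integral>\<^sup>+K. F x * indicator K x \<partial>count_space (components S)) \<partial>lebesgue)"
    by (simp add: nn_integral_completion)
  also have "\<dots> = (\<integral>\<^sup>+K. (\<integral>\<^sup>+x. F x * indicator K x \<partial>lebesgue) \<partial>count_space (components S))"
    using count meas by (intro nn_integral_count_space_nn_integral)
  finally show ?thesis by (simp add: nn_integral_completion)
qed

lemma ennreal_indicator_UN_eq_SUP:
  fixes F :: "'a \<Rightarrow> real" and A :: "nat \<Rightarrow> 'a set"
  shows "ennreal (F x) * indicator (\<Union>i. A i) x = (SUP i. ennreal (F x * indicat_real (A i) x))"
proof (cases "x \<in> (\<Union>i. A i)")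
  case True
  then obtain i where "x \<in> A i" by blast
  then have "ennreal (F x) \<le> (SUP i. ennreal (F x * indicat_real (A i) x))"
    by (intro SUP_upper2[of i]) auto
  moreover have "(SUP i. ennreal (F x * indicat_real (A i) x)) \<le> ennreal (F x)"
    by (intro SUP_least) (auto simp: indicator_def)
  ultimately show ?thesis using True by simp
next
  case False
  then have "x \<notin> A i" for i by blast
  with False show ?thesis by simp
qed

lemma borel_measurable_einterval_exhaustion:
  fixes F :: "real \<Rightarrow> real"
  assumes "\<alpha> < \<beta>"
    and meas: "\<And>r R. r < R \<Longrightarrow> {r..R} \<subseteq> einterval \<alpha> \<beta> \<Longrightarrow> (\<lambda>x. F x * indicat_real {r..R} x) \<in> borel_measurable lebesgue"
  shows "(\<lambda>x. ennreal (F x) * indicator (einterval \<alpha> \<beta>) x) \<in> borel_measurable lebesgue"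
proof -
  obtain u l :: "nat \<Rightarrow> real" where ul: "einterval \<alpha> \<beta> = (\<Union>i. {l i..u i})" "\<And>i. l i < u i"
    by (rule einterval_Icc_approximation[OF \<open>\<alpha> < \<beta>\<close>]) (rule that)
  show ?thesis
    unfolding ul(1) ennreal_indicator_UN_eq_SUP
  proof (intro borel_measurable_SUP measurable_compose[OF _ measurable_ennreal] meas ul(2))
    show "{l i..u i} \<subseteq> einterval \<alpha> \<beta>" for i unfolding ul(1) by (rule UN_upper) simp
  qed simp
qed

lemma nn_integral_einterval_le:
  fixes F :: "real \<Rightarrow> real"
  assumes "\<alpha> < \<beta>"
    and meas: "\<And>r R. r < R \<Longrightarrow> {r..R} \<subseteq> einterval \<alpha> \<beta> \<Longrightarrow> (\<lambda>x. F x * indicat_real {r..R} x) \<in> borel_measurable lebesgue"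
    and le: "\<And>r R. r < R \<Longrightarrow> {r..R} \<subseteq> einterval \<alpha> \<beta> \<Longrightarrow> (\<integral>\<^sup>+x\<in>{r..R}. ennreal (F x) \<partial>lborel) \<le> b"
  shows "(\<integral>\<^sup>+x\<in>einterval \<alpha> \<beta>. ennreal (F x) \<partial>lborel) \<le> b"
proof -
  obtain u l :: "nat \<Rightarrow> real" where ul: "einterval \<alpha> \<beta> = (\<Union>i. {l i..u i})" "\<And>i. l i < u i" "incseq u" "decseq l"
    by (rule einterval_Icc_approximation[OF \<open>\<alpha> < \<beta>\<close>]) (rule that)
  have sub: "{l i..u i} \<subseteq> einterval \<alpha> \<beta>" for i unfolding ul(1) by (rule UN_upper) simp
  have inc: "{l i..u i} \<subseteq> {l j..u j}" if "i \<le> j" for i j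
    using ul(3,4) that by (auto simp: incseq_def decseq_def intro: order_trans)
  let ?F = "\<lambda>i x. ennreal (F x * indicat_real {l i..u i} x)"
  have F_eq: "?F i x = ennreal (F x) * indicator {l i..u i} x" for i x by (simp add: indicator_def)
  have "(\<integral>\<^sup>+x\<in>einterval \<alpha> \<beta>. ennreal (F x) \<partial>lborel) = (\<integral>\<^sup>+x. (SUP i. ?F i x) \<partial>lebesgue)"
    unfolding ul(1) ennreal_indicator_UN_eq_SUP nn_integral_completion ..
  also have "\<dots> = (SUP i. (\<integral>\<^sup>+x. ?F i x \<partial>lebesgue))"
  proof (rule nn_integral_monotone_convergence_SUP)
    show "incseq ?F"
      unfolding F_eq incseq_def le_fun_def
    proof (intro allI impI mult_left_mono)
      show "indicator {l i..u i} x \<le> (indicator {l j..u j} x :: ennreal)" if "i \<le> j" for i j x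
        using subsetD[OF inc[OF that], of x] by (auto simp: indicator_def)
    qed simp
    show "?F i \<in> borel_measurable lebesgue" for i
      using meas[OF ul(2) sub] by (rule measurable_compose[OF _ measurable_ennreal])
  qed
  also have "\<dots> \<le> b"
    unfolding nn_integral_completion F_eq using le[OF ul(2) sub] by (intro SUP_least)
  finally show ?thesis .
qed

section \<open>The boundary term at the endpoints of a component\<close>

lemma nonneg_if_AE_nonneg:
  fixes f :: "real \<Rightarrow> real"
  assumes "open U" "continuous_on U f" and ae: "AE x in lborel. x \<in> U \<longrightarrow> f x \<ge> 0" and "x \<in> U"
  shows "f x \<ge> 0"
proof (rule ccontr)
  assume neg: "\<not> f x \<ge> 0"
  let ?V = "{y \<in> U. f y < 0}"
  have "?V = U \<inter> f -` {..<0}" by auto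
  then have "open ?V" using continuous_on_open_vimage[OF \<open>open U\<close>] assms(2) by (metis Int_commute open_lessThan)
  moreover have "x \<in> ?V" using neg \<open>x \<in> U\<close> by simp
  moreover have "negligible ?V"
  proof -
    obtain N where N: "N \<in> null_sets lborel" "{x. \<not> (x \<in> U \<longrightarrow> f x \<ge> 0)} \<subseteq> N"
      using ae by (auto simp: eventually_ae_filter)
    have "negligible N" using N(1) by (simp add: negligible_iff_null_sets null_sets_completionI)
    then show ?thesis by (rule negligible_subset) (use N(2) in auto)
  qed
  ultimately show False using open_not_negligible[of ?V] by blast
qed

text \<open>
  A finite endpoint of a component that belongs to \<open>U\<close> is a zero of \<open>f\<close>, as otherwise adjoining it
  would give a larger connected set.
\<close>
lemma component_endpoint_zero:
  fixes f :: "real \<Rightarrow> real"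
  assumes K: "einterval \<alpha> \<beta> \<in> components {x \<in> U. f x > 0}" and nonneg: "f e \<ge> 0" and "e \<in> U"
    and e: "ereal e = \<alpha> \<or> ereal e = \<beta>" and "\<alpha> < \<beta>"
  shows "f e = 0"
proof (rule ccontr)
  assume "f e \<noteq> 0"
  with nonneg \<open>e \<in> U\<close> have eS: "e \<in> {x \<in> U. f x > 0}" by simp
  have KS: "einterval \<alpha> \<beta> \<subseteq> {x \<in> U. f x > 0}" using K by (rule in_components_subset)
  have "connected (insert e (einterval \<alpha> \<beta>))"
  proof -
    have "is_interval (insert e (einterval \<alpha> \<beta>))"
      unfolding is_interval_1
    proof (intro ballI allI impI, elim conjE)
      fix y z w assume yz: "y \<in> insert e (einterval \<alpha> \<beta>)" "z \<in> insert e (einterval \<alpha> \<beta>)" "y \<le> w" "w \<le> z"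
      have "\<alpha> \<le> ereal y" "ereal z \<le> \<beta>" using yz(1,2) e \<open>\<alpha> < \<beta>\<close> by (auto simp: einterval_def)
      then have "\<alpha> \<le> ereal w" "ereal w \<le> \<beta>" using yz(3,4) by (meson ereal_less_eq(3) order_trans)+
      moreover have "ereal w \<noteq> \<alpha>" "ereal w \<noteq> \<beta>" if "w \<noteq> e"
        using yz e that \<open>\<alpha> < \<beta>\<close> by (auto simp: einterval_def)
      ultimately show "w \<in> insert e (einterval \<alpha> \<beta>)" by (auto simp: einterval_def order.order_iff_strict)
    qed
    then show ?thesis by (simp add: is_interval_connected)
  qed
  moreover have "einterval \<alpha> \<beta> \<inter> insert e (einterval \<alpha> \<beta>) \<noteq> {}" using in_components_nonempty[OF K] by blast
  ultimately have "insert e (einterval \<alpha> \<beta>) \<subseteq> einterval \<alpha> \<beta>"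
    using components_maximal[OF K] KS eS by blast
  then show False using e by (auto simp: einterval_def)
qed

lemma einterval_subset_bounds:
  assumes "\<alpha> < \<beta>" "einterval \<alpha> \<beta> \<subseteq> einterval a b"
  shows "a \<le> \<alpha>" "\<beta> \<le> b"
proof -
  show "a \<le> \<alpha>"
  proof (rule ccontr)
    assume "\<not> a \<le> \<alpha>"
    then have "\<alpha> < min a \<beta>" using assms(1) by auto
    then obtain z where "\<alpha> < ereal z" "ereal z < min a \<beta>" using ereal_dense2 by blast
    then have "z \<in> einterval \<alpha> \<beta>" "z \<notin> einterval a b" by (auto simp: einterval_def)
    with assms(2) show False by blast
  qed
  show "\<beta> \<le> b"
  proof (rule ccontr)
    assume "\<not> \<beta> \<le> b"
    then have "max \<alpha> b < \<beta>" using assms(1) by auto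
    then obtain z where "max \<alpha> b < ereal z" "ereal z < \<beta>" using ereal_dense2 by blast
    then have "z \<in> einterval \<alpha> \<beta>" "z \<notin> einterval a b" by (auto simp: einterval_def)
    with assms(2) show False by blast
  qed
qed

lemma boundary_term_eq: "boundary_term p Ht f x = signed_power p (deriv f x) * Ht (f x)"
  by (simp add: boundary_term_def signed_power_def)

lemma continuous_on_boundary_term:
  assumes "p \<ge> 2" "continuous_on U f" "continuous_on U (deriv f)" "continuous_on {0..} Ht"
    and "\<And>x. x \<in> U \<Longrightarrow> f x \<ge> 0"
  shows "continuous_on U (boundary_term p Ht f)"
proof -
  have "continuous_on U (\<lambda>x. signed_power p (deriv f x))"
    by (rule continuous_on_compose2[OF continuous_on_signed_power[OF assms(1)] assms(3)]) auto
  moreover have "continuous_on U (\<lambda>x. Ht (f x))"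
    using assms(5) by (intro continuous_on_compose2[OF assms(4,2)]) auto
  ultimately have "continuous_on U (\<lambda>x. signed_power p (deriv f x) * Ht (f x))"
    by (rule continuous_on_mult)
  then show ?thesis by (simp add: boundary_term_eq fun_eq_iff cong: continuous_on_cong)
qed

lemma boundary_term_zero:
  assumes "open U" "e \<in> U" "f differentiable (at e)" "\<And>x. x \<in> U \<Longrightarrow> f x \<ge> 0" "f e = 0"
  shows "boundary_term p Ht f e = 0"
proof -
  obtain d where d: "d > 0" "ball e d \<subseteq> U" using assms(1,2) by (meson openE)
  have "(f has_real_derivative deriv f e) (at e)"
    using assms(3) by (simp add: DERIV_deriv_iff_real_differentiable)
  then have "deriv f e = 0"
  proof (rule DERIV_local_min[OF _ d(1)])
    show "\<forall>y. \<bar>e - y\<bar> < d \<longrightarrow> f e \<le> f y"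
    proof (intro allI impI)
      fix y assume "\<bar>e - y\<bar> < d"
      then have "y \<in> ball e d" by (simp add: dist_real_def)
      then have "y \<in> U" using d(2) by blast
      then show "f e \<le> f y" using assms(4,5) by simp
    qed
  qed
  then show ?thesis by (simp add: boundary_term_def)
qed

text \<open>
  At the right end of a component the boundary term takes values that are at most \<open>\<epsilon>\<close>: by the
  assumption on the lower limit if the end is \<open>b\<close>, and otherwise because \<open>f\<close> vanishes there, has a
  minimum, and so the continuous boundary term is \<open>0\<close>.
\<close>
lemma boundary_term_upper_right:
  assumes lim: "Liminf (at_left b) (\<lambda>R. ereal (boundary_term p Ht f (real_of_ereal R))) \<le> 0"
    and K: "einterval \<alpha> \<beta> \<in> components {x \<in> einterval a b. f x > 0}" and "\<alpha> < \<beta>"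
    and cont: "continuous_on (einterval a b) (boundary_term p Ht f)"
    and diff: "\<And>x. x \<in> einterval a b \<Longrightarrow> f differentiable (at x)"
    and nonneg: "\<And>x. x \<in> einterval a b \<Longrightarrow> f x \<ge> 0"
    and t: "t \<in> einterval \<alpha> \<beta>" and "\<epsilon> > 0"
  shows "\<exists>R\<in>einterval \<alpha> \<beta>. t < R \<and> boundary_term p Ht f R \<le> \<epsilon>"
proof -
  have "einterval \<alpha> \<beta> \<subseteq> einterval a b" using in_components_subset[OF K] by blast
  note bounds = einterval_subset_bounds[OF \<open>\<alpha> < \<beta>\<close> this]
  have t': "\<alpha> < ereal t" "ereal t < \<beta>" using t by (auto simp: einterval_def)
  show ?thesis
  proof (cases "\<beta> = b")
    case True
    show ?thesis
    proof (rule ccontr)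
      assume no: "\<not> ?thesis"
      have big: "\<epsilon> \<le> boundary_term p Ht f R" if "t < R" "ereal R < b" for R
      proof -
        have "\<alpha> < ereal R" using t'(1) that(1) by (meson less_trans ereal_less(2) less_ereal.simps(1))
        then have "R \<in> einterval \<alpha> \<beta>" using that True by (simp add: einterval_def)
        with no that(1) show ?thesis by force
      qed
      have "\<forall>\<^sub>F R in at_left b. ereal \<epsilon> \<le> ereal (boundary_term p Ht f (real_of_ereal R))"
      proof (rule eventually_at_leftI)
        fix R assume "R \<in> {ereal t<..<b}"
        then obtain R' where "R = ereal R'" "t < R'" "ereal R' < b"
          by (cases R) auto
        then show "ereal \<epsilon> \<le> ereal (boundary_term p Ht f (real_of_ereal R))" using big by simp
      qed (use t' True in simp)
      then have "ereal \<epsilon> \<le> Liminf (at_left b) (\<lambda>R. ereal (boundary_term p Ht f (real_of_ereal R)))"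
        by (rule Liminf_bounded)
      with lim have "ereal \<epsilon> \<le> 0" by (rule order_trans[rotated])
      with \<open>\<epsilon> > 0\<close> show False by simp
    qed
  next
    case False
    with bounds(2) have "\<beta> < b" by simp
    with t'(2) obtain e where e: "\<beta> = ereal e" by (cases \<beta>) auto
    have "a < ereal e" using bounds(1) \<open>\<alpha> < \<beta>\<close> e by (metis order.strict_trans1)
    with \<open>\<beta> < b\<close> e have eU: "e \<in> einterval a b" by (simp add: einterval_def)
    have "f e = 0" using component_endpoint_zero[OF K nonneg[OF eU] eU _ \<open>\<alpha> < \<beta>\<close>] e by simp
    then have z: "boundary_term p Ht f e = 0"
      using boundary_term_zero[OF open_einterval eU diff[OF eU] nonneg] by blast
    have "isCont (boundary_term p Ht f) e" using cont eU by (simp add: continuous_on_eq_continuous_at)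
    then have "(boundary_term p Ht f \<longlongrightarrow> 0) (at_left e)"
      using z by (simp add: isCont_def filterlim_at_split)
    then have "\<forall>\<^sub>F x in at_left e. boundary_term p Ht f x < \<epsilon>"
      using \<open>\<epsilon> > 0\<close> by (rule order_tendstoD(2))
    moreover have "\<forall>\<^sub>F x in at_left e. x \<in> {t<..<e}"
      using t' e by (intro eventually_at_leftI[of t]) auto
    ultimately obtain R where R: "boundary_term p Ht f R < \<epsilon>" "t < R" "R < e"
      using eventually_happens'[OF trivial_limit_at_left_real eventually_conj] by fastforce
    moreover have "\<alpha> < ereal R" using t'(1) R(2) by (meson less_trans less_ereal.simps(1))
    ultimately show ?thesis using e by (intro bexI[of _ R]) (auto simp: einterval_def)
  qed
qed

lemma boundary_term_lower_left:
  assumes lim: "Limsup (at_right a) (\<lambda>r. ereal (boundary_term p Ht f (real_of_ereal r))) \<ge> 0"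
    and K: "einterval \<alpha> \<beta> \<in> components {x \<in> einterval a b. f x > 0}" and "\<alpha> < \<beta>"
    and cont: "continuous_on (einterval a b) (boundary_term p Ht f)"
    and diff: "\<And>x. x \<in> einterval a b \<Longrightarrow> f differentiable (at x)"
    and nonneg: "\<And>x. x \<in> einterval a b \<Longrightarrow> f x \<ge> 0"
    and t: "t \<in> einterval \<alpha> \<beta>" and "\<epsilon> > 0"
  shows "\<exists>r\<in>einterval \<alpha> \<beta>. r < t \<and> - \<epsilon> \<le> boundary_term p Ht f r"
proof -
  have "einterval \<alpha> \<beta> \<subseteq> einterval a b" using in_components_subset[OF K] by blast
  note bounds = einterval_subset_bounds[OF \<open>\<alpha> < \<beta>\<close> this]
  have t': "\<alpha> < ereal t" "ereal t < \<beta>" using t by (auto simp: einterval_def)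
  show ?thesis
  proof (cases "\<alpha> = a")
    case True
    show ?thesis
    proof (rule ccontr)
      assume no: "\<not> ?thesis"
      have small: "boundary_term p Ht f r \<le> - \<epsilon>" if "r < t" "a < ereal r" for r
      proof -
        have "ereal r < \<beta>" using t'(2) that(1) by (meson less_trans less_ereal.simps(1))
        then have "r \<in> einterval \<alpha> \<beta>" using that True by (simp add: einterval_def)
        with no that(1) show ?thesis by force
      qed
      have "\<forall>\<^sub>F r in at_right a. ereal (boundary_term p Ht f (real_of_ereal r)) \<le> ereal (- \<epsilon>)"
      proof (rule eventually_at_rightI)
        fix r assume "r \<in> {a<..<ereal t}"
        then obtain r' where "r = ereal r'" "r' < t" "a < ereal r'"
          by (cases r) auto
        then show "ereal (boundary_term p Ht f (real_of_ereal r)) \<le> ereal (- \<epsilon>)" using small by simp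
      qed (use t' True in simp)
      then have "Limsup (at_right a) (\<lambda>r. ereal (boundary_term p Ht f (real_of_ereal r))) \<le> ereal (- \<epsilon>)"
        by (rule Limsup_bounded)
      with lim have "0 \<le> ereal (- \<epsilon>)" by (rule order_trans)
      with \<open>\<epsilon> > 0\<close> show False by simp
    qed
  next
    case False
    with bounds(1) have "a < \<alpha>" by simp
    with t'(1) obtain e where e: "\<alpha> = ereal e" by (cases \<alpha>) auto
    have "ereal e < b" using bounds(2) \<open>\<alpha> < \<beta>\<close> e by (metis order.strict_trans2)
    with \<open>a < \<alpha>\<close> e have eU: "e \<in> einterval a b" by (simp add: einterval_def)
    have "f e = 0" using component_endpoint_zero[OF K nonneg[OF eU] eU _ \<open>\<alpha> < \<beta>\<close>] e by simp
    then have z: "boundary_term p Ht f e = 0"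
      using boundary_term_zero[OF open_einterval eU diff[OF eU] nonneg] by blast
    have "isCont (boundary_term p Ht f) e" using cont eU by (simp add: continuous_on_eq_continuous_at)
    then have "(boundary_term p Ht f \<longlongrightarrow> 0) (at_right e)"
      using z by (simp add: isCont_def filterlim_at_split)
    then have "\<forall>\<^sub>F x in at_right e. - \<epsilon> < boundary_term p Ht f x"
      using \<open>\<epsilon> > 0\<close> by (intro order_tendstoD(1)) auto
    moreover have "\<forall>\<^sub>F x in at_right e. x \<in> {e<..<t}"
      using t' e by (intro eventually_at_rightI[of _ t]) auto
    ultimately obtain r where r: "- \<epsilon> < boundary_term p Ht f r" "e < r" "r < t"
      using eventually_happens'[OF trivial_limit_at_right_real eventually_conj] by fastforce
    moreover have "ereal r < \<beta>" using t'(2) r(3) by (meson less_trans less_ereal.simps(1))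
    ultimately show ?thesis using e by (intro bexI[of _ r]) (auto simp: einterval_def)
  qed
qed

section \<open>The weighted inequality\<close>

theorem proposition4p2:
  fixes p :: real and a b :: ereal and h H Ht f :: "real \<Rightarrow> real"
  assumes "p \<ge> 2"
    and "a < b"
    and "continuous_on {0<..} h" and "\<And>y. y > 0 \<Longrightarrow> h y > 0"
    and "locally_abs_cont_on {0<..} H"
    and "AE y in lborel. y > 0 \<longrightarrow> (H has_real_derivative h y) (at y)"
    and "continuous_on {0..} Ht" and "\<And>y. y > 0 \<Longrightarrow> Ht y = H y"
    and "f \<in> R0_nonneg p Ht a b"
  shows "(\<integral>\<^sup>+x\<in>{x \<in> einterval a b. f x > 0}. ennreal (\<bar>deriv f x\<bar> powr p * h (f x)) \<partial>lborel)
       \<le> ennreal (sqrt (p - 1) powr p) *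
         (\<integral>\<^sup>+x\<in>{x \<in> einterval a b. f x > 0}.
            ennreal (\<bar>deriv (deriv f) x * T_transform H h (f x)\<bar> powr (p / 2) * h (f x)) \<partial>lborel)"
proof -
  define U where "U = einterval a b"
  define S where "S = {x \<in> U. f x > 0}"
  define A where "A x = \<bar>deriv f x\<bar> powr p * h (f x)" for x
  define B where "B x = \<bar>deriv (deriv f) x * T_transform H h (f x)\<bar> powr (p / 2) * h (f x)" for x
  define C where "C = ennreal ((p - 1) powr (p / 2))"
  have H: "(H has_real_derivative h y) (at y)" if "y > 0" for y
    using primitive_of_continuous_has_real_derivative[OF assms(3,5,6) that] .
  have diff: "f differentiable (at x)" if "x \<in> U" for x
    using assms(9) that unfolding R0_nonneg_def W21_loc_def U_def by blast
  have contg: "continuous_on U (deriv f)" and ac: "locally_abs_cont_on U (deriv f)"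
    and ae: "AE x in lborel. x \<in> U \<longrightarrow> f x \<ge> 0"
    and liminf: "Liminf (at_left b) (\<lambda>R. ereal (boundary_term p Ht f (real_of_ereal R))) \<le> 0"
    and limsup: "Limsup (at_right a) (\<lambda>r. ereal (boundary_term p Ht f (real_of_ereal r))) \<ge> 0"
    using assms(9) unfolding R0_nonneg_def W21_loc_def U_def by blast+
  have contf: "continuous_on U f"
    using diff by (meson continuous_at_imp_continuous_on differentiable_imp_continuous_within)
  have "open U" unfolding U_def by simp
  have nonneg: "f x \<ge> 0" if "x \<in> U" for x
    using nonneg_if_AE_nonneg[OF \<open>open U\<close> contf ae that] .
  have contbt: "continuous_on U (boundary_term p Ht f)"
    using continuous_on_boundary_term[OF assms(1) contf contg assms(7) nonneg] .
  have "S = U \<inter> f -` {0<..}" by (auto simp: S_def)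
  then have "open S" using continuous_on_open_vimage[OF \<open>open U\<close>] contf by (metis Int_commute open_greaterThan)
  have acI: "abs_cont_on_Icc r R (deriv f)" if "{r..R} \<subseteq> S" for r R
    using ac that unfolding locally_abs_cont_on_def S_def by blast
  have measA: "(\<lambda>x. A x * indicat_real {r..R} x) \<in> borel_measurable lebesgue" if "{r..R} \<subseteq> S" for r R
  proof -
    have sub: "{r..R} \<subseteq> U" using that by (auto simp: S_def)
    have "continuous_on {r..R} (\<lambda>x. h (f x))"
      using that by (intro continuous_on_compose2[OF assms(3) continuous_on_subset[OF contf sub]]) (auto simp: S_def)
    then have "continuous_on {r..R} A"
      unfolding A_def using continuous_on_subset[OF contg sub] assms(1)
      by (intro continuous_on_mult continuous_on_powr' continuous_intros) auto
    then have "(\<lambda>x. indicat_real {r..R} x *\<^sub>R A x) \<in> borel_measurable borel"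
      by (intro borel_measurable_continuous_on_indicator) auto
    then have "(\<lambda>x. indicat_real {r..R} x *\<^sub>R A x) \<in> borel_measurable lebesgue"
      by (auto intro: measurable_completion)
    then show ?thesis by (simp add: mult.commute)
  qed
  note core = energy_le_on_Icc[OF assms(1) _ _ _ _ assms(3,4) H, where f = f, folded A_def B_def]
  have diffS: "f differentiable (at x)" "f x > 0" if "x \<in> {r..R}" "{r..R} \<subseteq> S" for x r R
    using that diff by (auto simp: S_def)
  have measB: "(\<lambda>x. B x * indicat_real {r..R} x) \<in> borel_measurable lebesgue" if "r < R" "{r..R} \<subseteq> S" for r R
    using core(1)[OF that(1) diffS(1)[OF _ that(2)] acI[OF that(2)] diffS(2)[OF _ that(2)]] .
  have comp: "(\<lambda>x. ennreal (A x) * indicator K x) \<in> borel_measurable lebesgue \<and>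
      (\<lambda>x. ennreal (B x) * indicator K x) \<in> borel_measurable lebesgue \<and>
      (\<integral>\<^sup>+x\<in>K. ennreal (A x) \<partial>lborel) \<le> C * (\<integral>\<^sup>+x\<in>K. ennreal (B x) \<partial>lborel)"
    if K: "K \<in> components S" for K
  proof -
    obtain \<alpha> \<beta> where \<alpha>\<beta>: "\<alpha> < \<beta>" "K = einterval \<alpha> \<beta>"
      using open_connected_eq_einterval[of K] open_components[OF \<open>open S\<close> K] in_components_connected[OF K]
        in_components_nonempty[OF K] by metis
    have KS: "einterval \<alpha> \<beta> \<subseteq> S" using in_components_subset[OF K] \<alpha>\<beta>(2) by simp
    have K': "einterval \<alpha> \<beta> \<in> components {x \<in> einterval a b. f x > 0}"
      using K \<alpha>\<beta>(2) by (simp add: S_def U_def)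
    have btH: "boundary_term p Ht f x = signed_power p (deriv f x) * H (f x)" if "x \<in> einterval \<alpha> \<beta>" for x
      using that KS assms(8) by (auto simp: boundary_term_eq S_def)
    have "(\<integral>\<^sup>+x\<in>{s..t}. ennreal (A x) \<partial>lborel) \<le> C * (\<integral>\<^sup>+x\<in>K. ennreal (B x) \<partial>lborel)"
      if st: "s < t" "{s..t} \<subseteq> einterval \<alpha> \<beta>" for s t
    proof (rule ennreal_le_epsilon)
      fix e :: real assume "e > 0"
      \<comment> \<open>Each endpoint contributes at most \<open>p / 2 * \<epsilon>\<close> to the error.\<close>
      define \<epsilon> where "\<epsilon> = e / p"
      have \<epsilon>: "\<epsilon> > 0" "p * \<epsilon> = e" using \<open>e > 0\<close> assms(1) by (auto simp: \<epsilon>_def)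
      have stK: "s \<in> einterval \<alpha> \<beta>" "t \<in> einterval \<alpha> \<beta>" using st by auto
      obtain R where R: "R \<in> einterval \<alpha> \<beta>" "t < R" "boundary_term p Ht f R \<le> \<epsilon>"
        using boundary_term_upper_right[OF liminf K' \<alpha>\<beta>(1) contbt[unfolded U_def] 
            diff[unfolded U_def] nonneg[unfolded U_def] stK(2) \<epsilon>(1)] by blast
      obtain r where r: "r \<in> einterval \<alpha> \<beta>" "r < s" "- \<epsilon> \<le> boundary_term p Ht f r"
        using boundary_term_lower_left[OF limsup K' \<alpha>\<beta>(1) contbt[unfolded U_def] 
            diff[unfolded U_def] nonneg[unfolded U_def] stK(1) \<epsilon>(1)] by blast
      have rRK: "{r..R} \<subseteq> einterval \<alpha> \<beta>"
        using r(1) R(1) by (auto simp: einterval_def) (meson ereal_less_eq(3) order.strict_trans1 order.strict_trans2)+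
      have rR: "r < R" "{r..R} \<subseteq> S" using rRK KS r(2) R(2) st(1) by auto
      have "(\<integral>\<^sup>+x\<in>{s..t}. ennreal (A x) \<partial>lborel) \<le> (\<integral>\<^sup>+x\<in>{r..R}. ennreal (A x) \<partial>lborel)"
        using r(2) R(2) by (intro nn_integral_mono) (auto simp: indicator_def)
      also have "\<dots> \<le> C * (\<integral>\<^sup>+x\<in>{r..R}. ennreal (B x) \<partial>lborel) + ennreal (p * \<epsilon>)"
        unfolding C_def
        using core(2)[OF rR(1) diffS(1)[OF _ rR(2)] acI[OF rR(2)] diffS(2)[OF _ rR(2)], of \<epsilon>]
          \<epsilon>(1) R(3) r(3) btH[OF R(1)] btH[OF r(1)] by simp
      also have "\<dots> \<le> C * (\<integral>\<^sup>+x\<in>K. ennreal (B x) \<partial>lborel) + ennreal e"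
        unfolding \<epsilon>(2) \<alpha>\<beta>(2) using rRK
        by (intro add_mono mult_left_mono nn_integral_mono) (auto simp: indicator_def)
      finally show "(\<integral>\<^sup>+x\<in>{s..t}. ennreal (A x) \<partial>lborel) \<le> C * (\<integral>\<^sup>+x\<in>K. ennreal (B x) \<partial>lborel) + ennreal e" .
    qed
    then have "(\<integral>\<^sup>+x\<in>K. ennreal (A x) \<partial>lborel) \<le> C * (\<integral>\<^sup>+x\<in>K. ennreal (B x) \<partial>lborel)"
      unfolding \<alpha>\<beta>(2) using KS by (intro nn_integral_einterval_le[OF \<alpha>\<beta>(1)] measA) auto
    moreover have "(\<lambda>x. ennreal (A x) * indicator K x) \<in> borel_measurable lebesgue"
      unfolding \<alpha>\<beta>(2) using KS by (intro borel_measurable_einterval_exhaustion[OF \<alpha>\<beta>(1)] measA) auto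
    moreover have "(\<lambda>x. ennreal (B x) * indicator K x) \<in> borel_measurable lebesgue"
      unfolding \<alpha>\<beta>(2) using KS by (intro borel_measurable_einterval_exhaustion[OF \<alpha>\<beta>(1)] measB) auto
    ultimately show ?thesis by blast
  qed
  have "(\<integral>\<^sup>+x\<in>S. ennreal (A x) \<partial>lborel) = (\<integral>\<^sup>+K. (\<integral>\<^sup>+x\<in>K. ennreal (A x) \<partial>lborel) \<partial>count_space (components S))"
    using comp by (intro nn_integral_components[OF \<open>open S\<close>]) blast
  also have "\<dots> \<le> (\<integral>\<^sup>+K. C * (\<integral>\<^sup>+x\<in>K. ennreal (B x) \<partial>lborel) \<partial>count_space (components S))"
    using comp by (intro nn_integral_mono) simp
  also have "\<dots> = C * (\<integral>\<^sup>+K. (\<integral>\<^sup>+x\<in>K. ennreal (B x) \<partial>lborel) \<partial>count_space (components S))"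
    by (rule nn_integral_cmult) simp
  also have "(\<integral>\<^sup>+K. (\<integral>\<^sup>+x\<in>K. ennreal (B x) \<partial>lborel) \<partial>count_space (components S)) = (\<integral>\<^sup>+x\<in>S. ennreal (B x) \<partial>lborel)"
    using comp by (intro nn_integral_components[OF \<open>open S\<close>, symmetric]) blast
  also have "C = ennreal (sqrt (p - 1) powr p)"
    using assms(1) by (simp add: C_def powr_half_sqrt[symmetric] powr_powr)
  finally show ?thesis unfolding S_def U_def A_def B_def .
qed

end
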